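(* There is a uniform effective procedure which, given (as an oracle) a linear ordering $\mathcal{L}$ with universe $\omega$, produces a set $A = A_{\mathcal{L}} \subseteq \omega$ whose complement is c.e. in $\mathcal{L}$ (uniformly in $\mathcal{L}$), such that: if $\mathcal{L}$ is well-founded then $A$ is uniformly introreducible, and if $\mathcal{L}$ is ill-founded then $A$ is not introreducible.
   Context: An infinite set $A\subseteq\omega$ is introreducible if every infinite subset of $A$ computes $A$; it is uniformly introreducible if there is a single Turing functional $\Phi$ with $\Phi(S)=A$ for every infinite $S\subseteq A$. *)

theory Defs
  imports Main "HOL-Library.Nat_Bijection"
begin

text \<open>Oracle computability via partial recursive function programs
  (Kleene-style) relative to an oracle X :: nat \<Rightarrow> bool.  A program is an
  index; its semantics relative to X is the (deterministic) relation
  ev X p xs v: "program p on input list xs with oracle X halts with output v".\<close>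

datatype prog =
    Zero
  | Succ
  | Proj nat
  | Orc
  | Comp prog "prog list"
  | Prec prog prog
  | Mn prog

inductive ev :: "(nat \<Rightarrow> bool) \<Rightarrow> prog \<Rightarrow> nat list \<Rightarrow> nat \<Rightarrow> bool"
  for X :: "nat \<Rightarrow> bool" where
  ev_zero: "ev X Zero xs 0"
| ev_succ: "ev X Succ [x] (Suc x)"
| ev_proj: "i < length xs \<Longrightarrow> ev X (Proj i) xs (xs ! i)"
| ev_orc: "ev X Orc [x] (if X x then 1 else 0)"
| ev_comp: "list_all2 (\<lambda>g y. ev X g xs y) gs ys \<Longrightarrow> ev X f ys z \<Longrightarrow> ev X (Comp f gs) xs z"
| ev_prec0: "ev X f xs z \<Longrightarrow> ev X (Prec f g) (0 # xs) z"
| ev_precS: "ev X (Prec f g) (n # xs) r \<Longrightarrow> ev X g (n # r # xs) z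
              \<Longrightarrow> ev X (Prec f g) (Suc n # xs) z"
| ev_mn: "ev X f (y # xs) 0 \<Longrightarrow> (\<forall>z<y. \<exists>v. ev X f (z # xs) v \<and> v > 0)
              \<Longrightarrow> ev X (Mn f) xs y"

definition computes :: "prog \<Rightarrow> nat set \<Rightarrow> nat set \<Rightarrow> bool" where
  "computes p S A \<longleftrightarrow> (\<forall>n. ev (\<lambda>k. k \<in> S) p [n] (if n \<in> A then 1 else 0))"

definition introreducible :: "nat set \<Rightarrow> bool" where
  "introreducible A \<longleftrightarrow> infinite A \<and>
     (\<forall>S. infinite S \<and> S \<subseteq> A \<longrightarrow> (\<exists>p. computes p S A))"

definition uniformly_introreducible :: "nat set \<Rightarrow> bool" where
  "uniformly_introreducible A \<longleftrightarrow> infinite A \<and>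
     (\<exists>p. \<forall>S. infinite S \<and> S \<subseteq> A \<longrightarrow> computes p S A)"

definition rel_oracle :: "(nat \<times> nat) set \<Rightarrow> nat \<Rightarrow> bool" where
  "rel_oracle R = (\<lambda>k. prod_decode k \<in> R)"

definition dom_rel :: "(nat \<Rightarrow> bool) \<Rightarrow> prog \<Rightarrow> nat set" where
  "dom_rel X p = {n. \<exists>v. ev X p [n] v}"

end

theory Submission
  imports Defs "HOL-Library.Multiset" "HOL-Library.Infinite_Set"
begin

text \<open>Order the finite sets of elements of \<open>L\<close> by the largest element on which they differ. This order is
  well-founded if \<open>L\<close> is, and contains a dense chain if \<open>L\<close> is not. A finite injury construction
  enumerates the complement of \<open>A\<close>: its elements carry such finite sets as labels, and the numbers
  that survive the action of a requirement beyond its witness have strictly descending labels. If \<open>L\<close> is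
  well-founded, every infinite \<open>S \<subseteq> A\<close> contains two elements \<open>m < n\<close> beyond a given \<open>b\<close> with
  non-descending labels, and then \<open>b\<close> can no longer leave \<open>A\<close> after \<open>n\<close> has entered. Since elements code the
  history of the construction, \<open>S\<close> can tell whether \<open>b\<close> is still there. If \<open>L\<close> is ill-founded, an
  infinite descending \<open>S \<subseteq> A\<close> that computes \<open>A\<close> by no program is built by forcing. To diagonalise
  against a program, pick a label \<open>q\<close> inside the current interval of the dense chain: either some finite
  descending extension with labels above \<open>q\<close> computes the witness into \<open>A\<close>, whereupon the construction
  has removed the witness and rescued that extension, and \<open>S\<close> continues below \<open>q\<close>; or there is no such
  extension, and \<open>S\<close> stays above \<open>q\<close> for ever.\<close>

section \<open>Computable functionals\<close>

lemma ev_deterministic: "ev X p xs v \<Longrightarrow> ev X p xs v' \<Longrightarrow> v = v'"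
proof (induction arbitrary: v' rule: ev.induct)
  case (ev_comp xs gs ys f z)
  from ev_comp.prems obtain ys' where
    ys': "list_all2 (\<lambda>g y. ev X g xs y) gs ys'" "ev X f ys' v'"
    by (cases rule: ev.cases) auto
  have "ys = ys'"
    using ev_comp.IH(1) ys'(1)
    by (auto simp: list_all2_conv_all_nth intro!: nth_equalityI)
  then show ?case using ev_comp.IH(2) ys'(2) by blast
next
  case (ev_prec0 f xs z g)
  from ev_prec0.prems have "ev X f xs v'" by (cases rule: ev.cases) auto
  then show ?case using ev_prec0.IH by blast
next
  case (ev_precS f g n xs r z)
  from ev_precS.prems obtain r' where "ev X (Prec f g) (n # xs) r'" "ev X g (n # r' # xs) v'"
    by (cases rule: ev.cases) auto
  then show ?case using ev_precS.IH by metis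
next
  case (ev_mn f y xs)
  from ev_mn.prems have v': "ev X f (v' # xs) 0" "\<forall>z<v'. \<exists>v. ev X f (z # xs) v \<and> v > 0"
    by (cases rule: ev.cases, auto)+
  show ?case
  proof (cases y v' rule: linorder_cases)
    case less
    then show ?thesis using v'(2) ev_mn.IH by fastforce
  next
    case greater
    then show ?thesis using ev_mn.IH v'(1) by fastforce
  qed
qed (auto elim: ev.cases)

section \<open>Total functionals computed by one program for all oracles\<close>

definition computable_n :: "nat \<Rightarrow> ((nat \<Rightarrow> bool) \<Rightarrow> nat list \<Rightarrow> nat) \<Rightarrow> bool" where
  "computable_n k f \<longleftrightarrow> (\<exists>p. \<forall>X xs. length xs = k \<longrightarrow> ev X p xs (f X xs))"

definition computable :: "((nat \<Rightarrow> bool) \<Rightarrow> nat \<Rightarrow> nat) \<Rightarrow> bool" where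
  "computable f \<longleftrightarrow> (\<exists>p. \<forall>X x. ev X p [x] (f X x))"

definition computable2 :: "((nat \<Rightarrow> bool) \<Rightarrow> nat \<Rightarrow> nat \<Rightarrow> nat) \<Rightarrow> bool" where
  "computable2 f \<longleftrightarrow> (\<exists>p. \<forall>X x y. ev X p [x, y] (f X x y))"

lemma computableI: "computable_n 1 (\<lambda>X xs. f X (xs ! 0)) \<Longrightarrow> computable f"
  unfolding computable_n_def computable_def by (metis One_nat_def length_Cons list.size(3) nth_Cons_0)

lemma computable2I:
  assumes "computable_n 2 (\<lambda>X xs. f X (xs ! 0) (xs ! 1))"
  shows "computable2 f"
proof -
  obtain p where p: "\<And>X xs. length xs = 2 \<Longrightarrow> ev X p xs (f X (xs ! 0) (xs ! 1))"
    using assms unfolding computable_n_def by blast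
  have "ev X p [x, y] (f X x y)" for X x y
    using p[of "[x, y]" X] by simp
  then show ?thesis unfolding computable2_def by blast
qed

lemma computable_n_nth: "i < k \<Longrightarrow> computable_n k (\<lambda>X xs. xs ! i)"
  unfolding computable_n_def by (metis ev_proj)

lemma computable_n_zero: "computable_n k (\<lambda>X xs. 0)"
  unfolding computable_n_def by (metis ev_zero)

lemma computable_n_compose:
  assumes "computable h" "computable_n k f"
  shows "computable_n k (\<lambda>X xs. h X (f X xs))"
proof -
  obtain p q where p: "\<And>X x. ev X p [x] (h X x)"
    and q: "\<And>X xs. length xs = k \<Longrightarrow> ev X q xs (f X xs)"
    using assms unfolding computable_def computable_n_def by blast
  have "ev X (Comp p [q]) xs (h X (f X xs))" if "length xs = k" for X xs
    by (rule ev_comp[where ys = "[f X xs]"]) (simp_all add: p q that)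
  then show ?thesis unfolding computable_n_def by blast
qed

lemma computable_n_compose2:
  assumes "computable2 h" "computable_n k f" "computable_n k g"
  shows "computable_n k (\<lambda>X xs. h X (f X xs) (g X xs))"
proof -
  obtain p q r where p: "\<And>X x y. ev X p [x, y] (h X x y)"
    and q: "\<And>X xs. length xs = k \<Longrightarrow> ev X q xs (f X xs)"
    and r: "\<And>X xs. length xs = k \<Longrightarrow> ev X r xs (g X xs)"
    using assms unfolding computable2_def computable_n_def by blast
  have "ev X (Comp p [q, r]) xs (h X (f X xs) (g X xs))" if "length xs = k" for X xs
    by (rule ev_comp[where ys = "[f X xs, g X xs]"]) (simp_all add: p q r that)
  then show ?thesis unfolding computable_n_def by blast
qed

lemma computable_compose:
  "computable h \<Longrightarrow> computable f \<Longrightarrow> computable (\<lambda>X x. h X (f X x))"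
proof -
  assume "computable h" "computable f"
  then obtain p q where p: "\<And>X x. ev X p [x] (h X x)" and q: "\<And>X x. ev X q [x] (f X x)"
    unfolding computable_def by blast
  have "ev X (Comp p [q]) [x] (h X (f X x))" for X x
    by (rule ev_comp[where ys = "[f X x]"]) (simp_all add: p q)
  then show ?thesis unfolding computable_def by blast
qed

lemma computable_compose2:
  assumes "computable2 h" "computable f" "computable g"
  shows "computable (\<lambda>X x. h X (f X x) (g X x))"
proof -
  obtain p q r where p: "\<And>X x y. ev X p [x, y] (h X x y)"
    and q: "\<And>X x. ev X q [x] (f X x)" and r: "\<And>X x. ev X r [x] (g X x)"
    using assms unfolding computable2_def computable_def by blast
  have "ev X (Comp p [q, r]) [x] (h X (f X x) (g X x))" for X x
    by (rule ev_comp[where ys = "[f X x, g X x]"]) (simp_all add: p q r)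
  then show ?thesis unfolding computable_def by blast
qed

lemma ev_rec_nat:
  assumes "ev X p xs a" "\<And>i r. ev X q (i # r # xs) (g i r)"
  shows "ev X (Prec p q) (n # xs) (rec_nat a g n)"
  by (induction n) (auto intro: ev_prec0 ev_precS assms)

lemma computable_n_rec_nat:
  assumes a: "computable_n k a" and g: "computable_n (Suc (Suc k)) (\<lambda>X ys. g X (ys ! 0) (ys ! 1) (drop 2 ys))"
    and n: "computable_n k n"
  shows "computable_n k (\<lambda>X xs. rec_nat (a X xs) (\<lambda>i r. g X i r xs) (n X xs))"
proof -
  obtain p q r where p: "\<And>X xs. length xs = k \<Longrightarrow> ev X p xs (a X xs)"
    and q: "\<And>X ys. length ys = Suc (Suc k) \<Longrightarrow> ev X q ys (g X (ys ! 0) (ys ! 1) (drop 2 ys))"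
    and r: "\<And>X xs. length xs = k \<Longrightarrow> ev X r xs (n X xs)"
    using assms unfolding computable_n_def by blast
  have "ev X (Comp (Prec p q) (r # map Proj [0..<k])) xs
      (rec_nat (a X xs) (\<lambda>i r. g X i r xs) (n X xs))" if k: "length xs = k" for X xs
  proof (rule ev_comp)
    show "list_all2 (\<lambda>g y. ev X g xs y) (r # map Proj [0..<k]) (n X xs # xs)"
      by (auto simp: list_all2_conv_all_nth k r nth_Cons intro: ev_proj split: nat.split)
    show "ev X (Prec p q) (n X xs # xs) (rec_nat (a X xs) (\<lambda>i r. g X i r xs) (n X xs))"
      by (rule ev_rec_nat) (use p q[of "_ # _ # xs"] k in auto)
  qed
  then show ?thesis unfolding computable_n_def by blast
qed

lemma computable_n_Least:
  assumes f: "computable_n (Suc k) (\<lambda>X ys. f X (ys ! 0) (drop 1 ys))"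
    and ex: "\<And>X xs. length xs = k \<Longrightarrow> \<exists>y. f X y xs = 0"
  shows "computable_n k (\<lambda>X xs. LEAST y. f X y xs = 0)"
proof -
  obtain p where p: "\<And>X ys. length ys = Suc k \<Longrightarrow> ev X p ys (f X (ys ! 0) (drop 1 ys))"
    using f unfolding computable_n_def by blast
  have p': "ev X p (y # xs) (f X y xs)" if "length xs = k" for X y xs
    using p[of "y # xs" X] that by simp
  have "ev X (Mn p) xs (LEAST y. f X y xs = 0)" if k: "length xs = k" for X xs
  proof (rule ev_mn)
    show "ev X p ((LEAST y. f X y xs = 0) # xs) 0"
      using p'[OF k, of X "LEAST y. f X y xs = 0"] LeastI_ex[OF ex[OF k, of X]] by simp
    show "\<forall>z<LEAST y. f X y xs = 0. \<exists>v. ev X p (z # xs) v \<and> v > 0"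
      using p'[OF k] not_less_Least by blast
  qed
  then show ?thesis unfolding computable_n_def by blast
qed

lemma computable_Suc': "computable (\<lambda>X. Suc)"
  unfolding computable_def by (metis ev_succ)

lemma computable_oracle': "computable (\<lambda>X x. of_bool (X x))"
  unfolding computable_def of_bool_def by (metis ev_orc)

lemma computable_pred': "computable (\<lambda>X x. x - 1)"
proof -
  have "computable (\<lambda>X x. rec_nat 0 (\<lambda>i r. i) x)"
    by (rule computableI, rule computable_n_rec_nat) (auto intro: computable_n_nth computable_n_zero)
  moreover have "rec_nat 0 (\<lambda>i r. i) x = x - 1" for x by (cases x) auto
  ultimately show ?thesis by simp
qed

lemma computable2_add: "computable2 (\<lambda>X. (+))"
proof -
  have "computable2 (\<lambda>X x y. rec_nat x (\<lambda>i r. Suc r) y)"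
    by (rule computable2I, rule computable_n_rec_nat)
      (rule computable_n_nth computable_n_compose[OF computable_Suc'] | simp)+
  moreover have "rec_nat x (\<lambda>i r. Suc r) y = x + y" for x y by (induction y) auto
  ultimately show ?thesis by simp
qed

lemma computable2_diff: "computable2 (\<lambda>X. (-))"
proof -
  have "computable2 (\<lambda>X x y. rec_nat x (\<lambda>i r. r - 1) y)"
    by (rule computable2I, rule computable_n_rec_nat)
      (rule computable_n_nth computable_n_compose[OF computable_pred'] | simp only: | simp)+
  moreover have "rec_nat x (\<lambda>i r. r - 1) y = x - y" for x y by (induction y) auto
  ultimately show ?thesis by simp
qed

lemma computable_triangle: "computable (\<lambda>X. triangle)"
proof -
  have "computable (\<lambda>X x. rec_nat 0 (\<lambda>i r. r + Suc i) x)"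
    by (rule computableI, rule computable_n_rec_nat)
      (auto intro!: computable_n_nth computable_n_zero computable_n_compose2[OF computable2_add]
        computable_n_compose[OF computable_Suc'] simp del: add_Suc_right)
  moreover have "rec_nat 0 (\<lambda>i r. r + Suc i) x = triangle x" for x by (induction x) auto
  ultimately show ?thesis by simp
qed

subsection \<open>Pairs\<close>

definition pair :: "nat \<Rightarrow> nat \<Rightarrow> nat" where "pair a b = prod_encode (a, b)"
definition pfst :: "nat \<Rightarrow> nat" where "pfst z = fst (prod_decode z)"
definition psnd :: "nat \<Rightarrow> nat" where "psnd z = snd (prod_decode z)"

lemma pfst_pair [simp]: "pfst (pair a b) = a"
  and psnd_pair [simp]: "psnd (pair a b) = b"
  and pair_collapse [simp]: "pair (pfst z) (psnd z) = z"
  and pair_eq_iff [simp]: "pair a b = pair c d \<longleftrightarrow> a = c \<and> b = d"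
  by (simp_all add: pair_def pfst_def psnd_def)

lemma le_pair1: "a \<le> pair a b" and le_pair2: "b \<le> pair a b"
  by (simp_all add: pair_def le_prod_encode_1 le_prod_encode_2)

lemma pfst_le: "pfst z \<le> z" and psnd_le: "psnd z \<le> z"
  using le_pair1[of "pfst z" "psnd z"] le_pair2[of "psnd z" "pfst z"] by simp_all

lemma triangle_mono: "m \<le> n \<Longrightarrow> triangle m \<le> triangle n"
  by (rule lift_Suc_mono_le) auto

text \<open>Index of the Cantor diagonal on which \<open>z\<close> lies, that is, the sum of its two
  components. The truncated difference vanishes exactly when \<open>z < triangle (Suc k)\<close>,
  which gives the search the form treated by \<open>computable_n_Least\<close>.\<close>

definition diagonal :: "nat \<Rightarrow> nat" where
  "diagonal z = (LEAST k. Suc z - triangle (Suc k) = 0)"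

lemma diagonal_pair: "diagonal (pair a b) = a + b"
  unfolding diagonal_def
proof (rule Least_equality)
  show "Suc (pair a b) - triangle (Suc (a + b)) = 0"
    by (simp add: pair_def prod_encode_def)
  show "a + b \<le> k" if "Suc (pair a b) - triangle (Suc k) = 0" for k
    using that triangle_mono[of "Suc k" "a + b"]
    by (intro leI notI) (simp add: pair_def prod_encode_def)
qed

lemma computable_diagonal: "computable (\<lambda>X. diagonal)"
  unfolding diagonal_def
proof (rule computableI, rule computable_n_Least)
  show "computable_n (Suc 1) (\<lambda>X ys. Suc (drop 1 ys ! 0) - triangle (Suc (ys ! 0)))"
  proof -
    have "computable_n (Suc 1) (\<lambda>X ys. drop 1 ys ! 0)"
    proof -
      obtain p where p: "\<And>X ys. length ys = 2 \<Longrightarrow> ev X p ys (ys ! 1)"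
        using computable_n_nth[of 1 2] unfolding computable_n_def by auto
      have "ev X p ys (drop 1 ys ! 0)" if "length ys = Suc 1" for X ys
        using p[of ys X] that by simp
      then show ?thesis unfolding computable_n_def by blast
    qed
    then show ?thesis
      by (intro computable_n_compose2[OF computable2_diff] computable_n_compose[OF computable_Suc']
          computable_n_compose[OF computable_triangle] computable_n_nth) auto
  qed
  show "\<exists>y. Suc (xs ! 0) - triangle (Suc y) = 0" for xs :: "nat list"
    by (rule exI[of _ "xs ! 0"]) simp
qed

text \<open>Since \<open>prod_encode (a, b) = triangle (a + b) + a\<close>, the diagonal yields both
  components by subtraction; this makes the decoding functions computable.\<close>

lemma pfst_conv_diagonal: "pfst z = z - triangle (diagonal z)"
  and psnd_conv_diagonal: "psnd z = diagonal z - pfst z"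
  using diagonal_pair[of "pfst z" "psnd z"] prod_decode_inverse[of z]
  by (simp_all add: pfst_def psnd_def prod_encode_def pair_def split: prod.splits)

subsection \<open>Closure properties\<close>

lemma computable_id: "computable (\<lambda>X x. x)"
  by (rule computableI) (simp add: computable_n_nth)

lemmas computable_Suc = computable_compose[OF computable_Suc']
lemmas computable_plus = computable_compose2[OF computable2_add]
lemmas computable_minus = computable_compose2[OF computable2_diff]

lemma computable_const: "computable (\<lambda>X x. c)"
proof (induction c)
  case 0
  show ?case unfolding computable_def by (metis ev_zero)
qed (rule computable_Suc)

lemma computable_pfst: "computable f \<Longrightarrow> computable (\<lambda>X x. pfst (f X x))"
  unfolding pfst_conv_diagonal
  by (intro computable_minus computable_compose[OF computable_triangle] computable_compose[OF computable_diagonal])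

lemma computable_psnd: "computable f \<Longrightarrow> computable (\<lambda>X x. psnd (f X x))"
  unfolding psnd_conv_diagonal
  by (intro computable_minus computable_pfst computable_compose[OF computable_diagonal])

lemma computable_pair:
  "computable f \<Longrightarrow> computable g \<Longrightarrow> computable (\<lambda>X x. pair (f X x) (g X x))"
  unfolding pair_def prod_encode_def prod.case
  by (intro computable_plus computable_compose[OF computable_triangle])

text \<open>Parameter, counter and accumulator reach the step packed as
  \<open>pair x (pair i r)\<close>, so that the closure rules for unary functionals apply to the
  step as well.\<close>

lemma computable_rec_nat:
  assumes "computable a" "computable (\<lambda>X z. g X (pfst z) (pfst (psnd z)) (psnd (psnd z)))" "computable n"
  shows "computable (\<lambda>X x. rec_nat (a X x) (\<lambda>i r. g X x i r) (n X x))"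
proof -
  obtain p q r where p: "\<And>X x. ev X p [x] (a X x)"
    and q: "\<And>X z. ev X q [z] (g X (pfst z) (pfst (psnd z)) (psnd (psnd z)))"
    and r: "\<And>X x. ev X r [x] (n X x)"
    using assms unfolding computable_def by blast
  obtain pr where pr: "\<And>X x y. ev X pr [x, y] (pair x y)"
  proof -
    have "computable2 (\<lambda>X. pair)"
      unfolding pair_def prod_encode_def prod.case
      by (intro computable2I computable_n_compose2[OF computable2_add]
        computable_n_compose[OF computable_triangle] computable_n_nth) auto
    then show ?thesis using that unfolding computable2_def by blast
  qed
  let ?q = "Comp q [Comp pr [Proj 2, Comp pr [Proj 0, Proj 1]]]"
  have proj: "ev X (Proj 0) [i, s, x] i" "ev X (Proj 1) [i, s, x] s" "ev X (Proj 2) [i, s, x] x" for X i s x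
    using ev_proj[of 0 "[i, s, x]" X] ev_proj[of 1 "[i, s, x]" X] ev_proj[of 2 "[i, s, x]" X] by simp_all
  have pr2: "ev X (Comp pr [Proj 0, Proj 1]) [i, s, x] (pair i s)" for X i s x
    by (rule ev_comp[where ys = "[i, s]"]) (simp_all add: proj pr proj[simplified])
  have pr3: "ev X (Comp pr [Proj 2, Comp pr [Proj 0, Proj 1]]) [i, s, x] (pair x (pair i s))" for X i s x
    by (rule ev_comp[where ys = "[x, pair i s]"]) (simp_all add: proj pr pr2 pr2[simplified])
  have q': "ev X ?q [i, s, x] (g X x i s)" for X i s x
  proof (rule ev_comp)
    show "list_all2 (\<lambda>g y. ev X g [i, s, x] y) [Comp pr [Proj 2, Comp pr [Proj 0, Proj 1]]] [pair x (pair i s)]"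
      by (simp only: list_all2_Cons list_all2_Nil2 pr3 simp_thms)
    show "ev X q [pair x (pair i s)] (g X x i s)"
      using q[of X "pair x (pair i s)"] by simp
  qed
  have "ev X (Comp (Prec p ?q) [r, Proj 0]) [x] (rec_nat (a X x) (\<lambda>i r. g X x i r) (n X x))" for X x
  proof (rule ev_comp)
    show "list_all2 (\<lambda>g y. ev X g [x] y) [r, Proj 0] [n X x, x]"
      using r[of X x] ev_proj[of 0 "[x]" X] by simp
    show "ev X (Prec p ?q) [n X x, x] (rec_nat (a X x) (\<lambda>i r. g X x i r) (n X x))"
      by (rule ev_rec_nat[OF p]) (rule q')
  qed
  then show ?thesis unfolding computable_def by blast
qed

section \<open>Decidable predicates, unbounded and bounded search\<close>

definition decidable :: "((nat \<Rightarrow> bool) \<Rightarrow> nat \<Rightarrow> bool) \<Rightarrow> bool" where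
  "decidable P \<longleftrightarrow> computable (\<lambda>X x. of_bool (P X x))"

lemma decidable_pos: "computable f \<Longrightarrow> decidable (\<lambda>X x. 0 < f X x)"
proof -
  assume "computable f"
  then have "computable (\<lambda>X x. 1 - (1 - f X x))" by (intro computable_minus computable_const)
  moreover have "1 - (1 - f X x) = of_bool (0 < f X x)" for X x by auto
  ultimately show ?thesis by (simp add: decidable_def)
qed

lemma decidable_not: "decidable P \<Longrightarrow> decidable (\<lambda>X x. \<not> P X x)"
proof -
  assume "decidable P"
  then have "computable (\<lambda>X x. 1 - of_bool (P X x))"
    unfolding decidable_def by (intro computable_minus computable_const)
  moreover have "1 - of_bool (P X x) = (of_bool (\<not> P X x) :: nat)" for X x by auto
  ultimately show ?thesis by (simp add: decidable_def)
qed

lemma decidable_or: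
  assumes "decidable P" "decidable Q" shows "decidable (\<lambda>X x. P X x \<or> Q X x)"
proof -
  have "decidable (\<lambda>X x. 0 < (of_bool (P X x) + of_bool (Q X x) :: nat))"
    using assms unfolding decidable_def[of P] decidable_def[of Q] by (intro decidable_pos computable_plus)
  moreover have "0 < (of_bool (P X x) + of_bool (Q X x) :: nat) \<longleftrightarrow> P X x \<or> Q X x" for X x by auto
  ultimately show ?thesis by simp
qed

lemma decidable_and:
  assumes "decidable P" "decidable Q" shows "decidable (\<lambda>X x. P X x \<and> Q X x)"
proof -
  have "decidable (\<lambda>X x. \<not> (\<not> P X x \<or> \<not> Q X x))" using assms by (intro decidable_not decidable_or)
  then show ?thesis by simp
qed

lemma decidable_imp:
  assumes "decidable P" "decidable Q" shows "decidable (\<lambda>X x. P X x \<longrightarrow> Q X x)"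
proof -
  have "decidable (\<lambda>X x. \<not> P X x \<or> Q X x)" using assms by (intro decidable_not decidable_or)
  then show ?thesis by (simp only: imp_conv_disj)
qed

lemma decidable_less:
  assumes "computable f" "computable g" shows "decidable (\<lambda>X x. f X x < g X x)"
  using decidable_pos[OF computable_minus[OF assms(2,1)]] by simp

lemma decidable_le:
  assumes "computable f" "computable g" shows "decidable (\<lambda>X x. f X x \<le> g X x)"
  using decidable_not[OF decidable_less[OF assms(2,1)]] by (simp add: not_less)

lemma decidable_eq:
  assumes "computable f" "computable g" shows "decidable (\<lambda>X x. f X x = g X x)"
  using decidable_and[OF decidable_le[OF assms] decidable_le[OF assms(2,1)]] by (simp add: eq_iff)

lemma decidable_compose: "decidable P \<Longrightarrow> computable f \<Longrightarrow> decidable (\<lambda>X x. P X (f X x))"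
  unfolding decidable_def by (rule computable_compose)

lemma decidable_oracle: "computable f \<Longrightarrow> decidable (\<lambda>X x. X (f X x))"
  unfolding decidable_def by (rule computable_compose[OF computable_oracle'])

lemma computable_if:
  assumes "decidable P" "computable f" "computable g"
  shows "computable (\<lambda>X x. if P X x then f X x else g X x)"
proof -
  have "computable (\<lambda>X x. rec_nat (g X x) (\<lambda>i r. f X x) (of_bool (P X x)))"
    using assms unfolding decidable_def
    by (intro computable_rec_nat computable_compose[OF assms(2)] computable_pfst computable_id)
  moreover have "rec_nat (g X x) (\<lambda>i r. f X x) (of_bool (P X x)) = (if P X x then f X x else g X x)" for X x
    by simp
  ultimately show ?thesis by simp
qed

text \<open>No witness is assumed to exist, so the search may diverge. The equivalence describes its
  halting exactly, as c.e. sets and searches that succeed only on some oracles require.\<close>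

lemma ev_Mn_decidable:
  assumes "decidable (\<lambda>X z. P X (pfst z) (psnd z))"
  shows "\<exists>p. \<forall>X x v. ev X p [x] v \<longleftrightarrow> P X x v \<and> (\<forall>y<v. \<not> P X x y)"
proof -
  obtain p where p: "\<And>X z. ev X p [z] (of_bool (\<not> P X (pfst z) (psnd z)))"
    using decidable_not[OF assms] unfolding decidable_def computable_def by blast
  obtain pr where pr: "\<And>X x y. ev X pr [y, x] (pair x y)"
  proof -
    have "computable2 (\<lambda>X y x. pair x y)"
      unfolding pair_def prod_encode_def prod.case
      by (intro computable2I computable_n_compose2[OF computable2_add]
        computable_n_compose[OF computable_triangle] computable_n_nth) auto
    then show ?thesis using that unfolding computable2_def by blast
  qed
  let ?q = "Comp p [pr]"
  have q: "ev X ?q [y, x] (of_bool (\<not> P X x y))" for X x y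
    by (rule ev_comp[where ys = "[pair x y]"]) (use pr p[of X "pair x y"] in simp_all)
  have q_iff: "ev X ?q [y, x] v \<longleftrightarrow> v = of_bool (\<not> P X x y)" for X x y v
    using q ev_deterministic by blast
  have "ev X (Mn ?q) [x] v \<longleftrightarrow> P X x v \<and> (\<forall>y<v. \<not> P X x y)" for X x v
  proof
    assume "ev X (Mn ?q) [x] v"
    then have "ev X ?q [v, x] 0" "\<forall>z<v. \<exists>u. ev X ?q [z, x] u \<and> u > 0"
      by (cases rule: ev.cases; simp)+
    then show "P X x v \<and> (\<forall>y<v. \<not> P X x y)"
      unfolding q_iff by auto
  next
    assume "P X x v \<and> (\<forall>y<v. \<not> P X x y)"
    then show "ev X (Mn ?q) [x] v"
      by (intro ev_mn) (unfold q_iff, auto)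
  qed
  then show ?thesis by blast
qed

lemma computable_Least:
  assumes "decidable (\<lambda>X z. P X (pfst z) (psnd z))" "\<And>X x. \<exists>y. P X x y"
  shows "computable (\<lambda>X x. LEAST y. P X x y)"
proof -
  obtain p where "\<And>X x v. ev X p [x] v \<longleftrightarrow> P X x v \<and> (\<forall>y<v. \<not> P X x y)"
    using ev_Mn_decidable[OF assms(1)] by blast
  then have "ev X p [x] (LEAST y. P X x y)" for X x
    using LeastI_ex[OF assms(2)] not_less_Least by blast
  then show ?thesis unfolding computable_def by blast
qed

lemma decidable_bex:
  assumes P: "decidable (\<lambda>X z. P X (pfst z) (psnd z))" and b: "computable b"
  shows "decidable (\<lambda>X x. \<exists>i<b X x. P X x i)"
proof -
  \<comment> \<open>The alternative \<open>i = b X x\<close> makes the search total; a result below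
    the bound is a genuine witness.\<close>
  have "computable (\<lambda>X x. LEAST i. P X x i \<or> i = b X x)"
    by (rule computable_Least)
      (intro decidable_or P decidable_eq computable_compose[OF b] computable_pfst computable_psnd computable_id, blast)
  then have "decidable (\<lambda>X x. (LEAST i. P X x i \<or> i = b X x) < b X x)"
    using b by (intro decidable_less)
  moreover have "(LEAST i. P X x i \<or> i = b X x) < b X x \<longleftrightarrow> (\<exists>i<b X x. P X x i)" for X x
  proof
    assume "(LEAST i. P X x i \<or> i = b X x) < b X x"
    then show "\<exists>i<b X x. P X x i"
      using LeastI[of "\<lambda>i. P X x i \<or> i = b X x" "b X x"] by auto
  next
    assume "\<exists>i<b X x. P X x i"
    then obtain i where "i < b X x" "P X x i" by blast
    then show "(LEAST i. P X x i \<or> i = b X x) < b X x"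
      using Least_le[of "\<lambda>i. P X x i \<or> i = b X x" i] by auto
  qed
  ultimately show ?thesis by simp
qed

lemma decidable_ball:
  assumes P: "decidable (\<lambda>X z. P X (pfst z) (psnd z))" and b: "computable b"
  shows "decidable (\<lambda>X x. \<forall>i<b X x. P X x i)"
proof -
  have "decidable (\<lambda>X x. \<not> (\<exists>i<b X x. \<not> P X x i))"
    using assms by (intro decidable_not decidable_bex)
  then show ?thesis by simp
qed

subsection \<open>Codes of finite sets\<close>

lemma computable_times:
  assumes "computable f" "computable g"
  shows "computable (\<lambda>X x. f X x * g X x)"
proof -
  have "computable (\<lambda>X x. rec_nat 0 (\<lambda>i r. r + f X x) (g X x))"
    using assms(2) by (intro computable_rec_nat computable_plus computable_compose[OF assms(1)]
        computable_pfst computable_psnd computable_const computable_id)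
  moreover have "rec_nat 0 (\<lambda>i r. r + a) b = a * b" for a b :: nat by (induction b) auto
  ultimately show ?thesis by simp
qed

lemma computable_power2:
  assumes "computable f"
  shows "computable (\<lambda>X x. 2 ^ f X x)"
proof -
  have "computable (\<lambda>X x. rec_nat 1 (\<lambda>i r. r + r) (f X x))"
    using assms by (intro computable_rec_nat computable_plus
        computable_pfst computable_psnd computable_const computable_id)
  moreover have "rec_nat 1 (\<lambda>i r. r + r) b = (2::nat) ^ b" for b :: nat by (induction b) auto
  ultimately show ?thesis by simp
qed

text \<open>Bit \<open>k\<close> of \<open>x\<close> is set iff \<open>x div 2 ^ k\<close> is odd,
  hence of the form \<open>h + Suc h\<close>. With bounded quantifiers, sums, products and powers
  only, decidability follows from the closure rules.\<close>

lemma mem_set_decode_iff: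
  "k \<in> set_decode x \<longleftrightarrow> (\<exists>h<Suc x. \<exists>r<2 ^ k. x = (h + Suc h) * 2 ^ k + r)"
proof
  assume "k \<in> set_decode x"
  then have "odd (x div 2 ^ k)" by (simp add: set_decode_def)
  then obtain h where h: "x div 2 ^ k = 2 * h + 1" by (auto elim: oddE)
  have "2 * h + 1 = h + Suc h" by simp
  then have "x = (h + Suc h) * 2 ^ k + x mod 2 ^ k" using div_mult_mod_eq[of x "2 ^ k"] h by metis
  moreover have "x mod 2 ^ k < 2 ^ k" by simp
  moreover have "x div 2 ^ k \<le> x" by simp
  then have "h < Suc x" using h by linarith
  ultimately show "\<exists>h<Suc x. \<exists>r<2 ^ k. x = (h + Suc h) * 2 ^ k + r" by blast
next
  assume "\<exists>h<Suc x. \<exists>r<2 ^ k. x = (h + Suc h) * 2 ^ k + r"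
  then obtain h r where "r < 2 ^ k" "x = (h + Suc h) * 2 ^ k + r" by blast
  then have "x div 2 ^ k = h + Suc h" by (simp only: div_mult_self3) simp
  then show "k \<in> set_decode x" by (simp add: set_decode_def)
qed

lemma decidable_mem:
  assumes "computable f" "computable g"
  shows "decidable (\<lambda>X x. f X x \<in> set_decode (g X x))"
  unfolding mem_set_decode_iff
  by (intro decidable_bex decidable_eq computable_plus computable_times computable_power2 computable_Suc
      computable_compose[OF assms(1)] computable_compose[OF assms(2)] computable_pfst computable_psnd
      computable_id)

lemma set_encode_Collect_less:
  "set_encode {k. k < n \<and> P k} = rec_nat 0 (\<lambda>i r. if P i then r + 2 ^ i else r) n"
proof (induction n)
  case (Suc n)
  have "{k. k < Suc n \<and> P k} = (if P n then insert n {k. k < n \<and> P k} else {k. k < n \<and> P k})"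
    by (auto simp: less_Suc_eq)
  then show ?case using Suc by auto
qed simp

lemma computable_set_encode:
  assumes "decidable (\<lambda>X z. P X (pfst z) (psnd z))" "computable n"
  shows "computable (\<lambda>X x. set_encode {k. k < n X x \<and> P X x k})"
proof -
  have "decidable (\<lambda>X z. P X (pfst z) (pfst (psnd z)))"
    using decidable_compose[OF assms(1), of "\<lambda>X z. pair (pfst z) (pfst (psnd z))"]
    by (simp add: computable_pair computable_pfst computable_psnd computable_id)
  then show ?thesis unfolding set_encode_Collect_less
    by (intro computable_rec_nat computable_if computable_plus computable_power2
      computable_pfst computable_psnd computable_id computable_const assms(2))
qed

lemma mem_set_decode_less: "k \<in> set_decode x \<Longrightarrow> k < x"
proof -
  assume "k \<in> set_decode x"
  then have "odd (x div 2 ^ k)" by (simp add: set_decode_def)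
  then have "2 ^ k \<le> x" by (metis div_less even_zero not_less)
  then show ?thesis using less_exp[of k] by linarith
qed

lemmas computable_intros =
  computable_id computable_const computable_Suc computable_plus computable_minus computable_times
  computable_power2 computable_pfst computable_psnd computable_pair computable_if computable_rec_nat
  computable_set_encode
  decidable_not decidable_or decidable_and decidable_imp decidable_less decidable_le decidable_eq
  decidable_bex decidable_ball decidable_mem decidable_oracle

section \<open>Certificates of halting computations\<close>

fun code :: "prog \<Rightarrow> nat" where
  "code Zero = pair 0 0"
| "code Succ = pair 1 0"
| "code (Proj i) = pair 2 i"
| "code Orc = pair 3 0"
| "code (Comp f gs) = pair 4 (pair (code f) (list_encode (map code gs)))"
| "code (Prec f g) = pair 5 (pair (code f) (code g))"
| "code (Mn f) = pair 6 (code f)"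

text \<open>These functions work on the codes of \<open>list_encode\<close>, in which 0 is the empty
  list and a nonempty list is the successor of a pair.\<close>

definition lcons :: "nat \<Rightarrow> nat \<Rightarrow> nat" where "lcons x l = Suc (pair x l)"
definition lhd :: "nat \<Rightarrow> nat" where "lhd l = pfst (l - 1)"
definition ltl :: "nat \<Rightarrow> nat" where "ltl l = psnd (l - 1)"

lemma lcons_simps [simp]: "lhd (lcons x l) = x" "ltl (lcons x l) = l" "lcons x l > 0"
  "lcons x (list_encode xs) = list_encode (x # xs)"
  by (simp_all add: lhd_def ltl_def lcons_def) (simp add: pair_def)

lemma lcons_collapse: "l > 0 \<Longrightarrow> lcons (lhd l) (ltl l) = l"
  by (simp add: lhd_def ltl_def lcons_def)

lemma list_decode_lcons [simp]: "list_decode (lcons x l) = x # list_decode l"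
  by (metis lcons_simps(4) list_decode_inverse list_encode_inverse)

definition claim :: "nat \<Rightarrow> nat \<Rightarrow> nat \<Rightarrow> nat \<Rightarrow> nat" where
  "claim k e xs v = pair k (pair e (pair xs v))"

text \<open>A claim of kind 0 says that the program \<open>e\<close> maps the argument list \<open>xs\<close> to \<open>v\<close>, one of kind 1
  that the program list \<open>e\<close> maps \<open>xs\<close> pointwise to the list \<open>v\<close>, and one of kind 2 that \<open>e\<close> takes
  positive values on \<open>z # xs\<close> for all \<open>z < v\<close>. The last two turn the rules for composition and
  minimisation, which have a variable number of premises, into rules with at most two premises.\<close>

definition justified :: "(nat \<Rightarrow> nat \<Rightarrow> bool) \<Rightarrow> (nat \<Rightarrow> bool) \<Rightarrow> nat \<Rightarrow> nat \<Rightarrow> nat \<Rightarrow> nat \<Rightarrow> nat \<Rightarrow> bool" where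
  "justified Or Q B k e xs v \<longleftrightarrow>
    k = 0 \<and> pfst e = 0 \<and> v = 0
  \<or> k = 0 \<and> pfst e = 1 \<and> v > 0 \<and> xs = lcons (v - 1) 0
  \<or> k = 0 \<and> pfst e = 2 \<and> xs > 0 \<and> psnd e = 0 \<and> v = lhd xs
  \<or> k = 0 \<and> pfst e = 2 \<and> xs > 0 \<and> psnd e > 0 \<and> Q (claim 0 (pair 2 (psnd e - 1)) (ltl xs) v)
  \<or> k = 0 \<and> pfst e = 3 \<and> xs = lcons (lhd xs) 0 \<and> Or (lhd xs) v
  \<or> k = 0 \<and> pfst e = 4 \<and> (\<exists>ys<B. Q (claim 1 (psnd (psnd e)) xs ys) \<and> Q (claim 0 (pfst (psnd e)) ys v))
  \<or> k = 0 \<and> pfst e = 5 \<and> xs > 0 \<and> lhd xs = 0 \<and> Q (claim 0 (pfst (psnd e)) (ltl xs) v)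
  \<or> k = 0 \<and> pfst e = 5 \<and> xs > 0 \<and> lhd xs > 0 \<and>
      (\<exists>r<B. Q (claim 0 e (lcons (lhd xs - 1) (ltl xs)) r) \<and>
             Q (claim 0 (psnd (psnd e)) (lcons (lhd xs - 1) (lcons r (ltl xs))) v))
  \<or> k = 0 \<and> pfst e = 6 \<and> Q (claim 2 (psnd e) xs v) \<and> Q (claim 0 (psnd e) (lcons v xs) 0)
  \<or> k = 1 \<and> e = 0 \<and> v = 0
  \<or> k = 1 \<and> e > 0 \<and> v > 0 \<and> Q (claim 0 (lhd e) xs (lhd v)) \<and> Q (claim 1 (ltl e) xs (ltl v))
  \<or> k = 2 \<and> v = 0
  \<or> k = 2 \<and> v > 0 \<and> Q (claim 2 e xs (v - 1)) \<and> (\<exists>r<B. r > 0 \<and> Q (claim 0 e (lcons (v - 1) xs) r))"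

text \<open>A member \<open>pair t f\<close> of the coded set is the claim \<open>f\<close> with
  time stamp \<open>t\<close>. Premises must carry smaller stamps, which excludes circular
  justifications. \<open>C\<close> also bounds the search for intermediate values, since it exceeds
  every number occurring in its members.\<close>

definition certificate :: "(nat \<Rightarrow> nat \<Rightarrow> bool) \<Rightarrow> nat \<Rightarrow> bool" where
  "certificate Or C \<longleftrightarrow> (\<forall>y<C. y \<in> set_decode C \<longrightarrow>
     justified Or (\<lambda>f. \<exists>t<pfst y. pair t f \<in> set_decode C) C (pfst (psnd y)) (pfst (psnd (psnd y)))
       (pfst (psnd (psnd (psnd y)))) (psnd (psnd (psnd (psnd y)))))"

definition certifies :: "(nat \<Rightarrow> nat \<Rightarrow> bool) \<Rightarrow> nat \<Rightarrow> nat \<Rightarrow> bool" where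
  "certifies Or C f \<longleftrightarrow> certificate Or C \<and> (\<exists>t<C. pair t f \<in> set_decode C)"

text \<open>Queries at or beyond \<open>s\<close> get no answer, so a certificate over
  \<open>restr X s\<close> depends only on the oracle below \<open>s\<close> and survives an
  increase of \<open>s\<close>.\<close>

definition restr :: "(nat \<Rightarrow> bool) \<Rightarrow> nat \<Rightarrow> nat \<Rightarrow> nat \<Rightarrow> bool" where
  "restr X s x v \<longleftrightarrow> x < s \<and> v = of_bool (X x)"

lemma certificate_iff:
  "certificate Or C \<longleftrightarrow> (\<forall>t k e xs v. pair t (claim k e xs v) \<in> set_decode C \<longrightarrow>
     justified Or (\<lambda>f. \<exists>t'<t. pair t' f \<in> set_decode C) C k e xs v)" (is "_ \<longleftrightarrow> ?R")
proof
  assume "certificate Or C"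
  then have "justified Or (\<lambda>f. \<exists>t'<t. pair t' f \<in> set_decode C) C k e xs v"
    if "pair t (claim k e xs v) \<in> set_decode C" for t k e xs v
    using mem_set_decode_less[OF that] that unfolding certificate_def
    by (elim allE[of _ "pair t (claim k e xs v)"]) (simp add: claim_def)
  then show ?R by blast
next
  assume R: ?R
  show "certificate Or C"
    unfolding certificate_def
  proof (intro allI impI)
    fix y assume "y \<in> set_decode C"
    moreover have "y = pair (pfst y) (claim (pfst (psnd y)) (pfst (psnd (psnd y)))
       (pfst (psnd (psnd (psnd y)))) (psnd (psnd (psnd (psnd y)))))"
      by (simp add: claim_def)
    ultimately have "pair (pfst y) (claim (pfst (psnd y)) (pfst (psnd (psnd y)))
       (pfst (psnd (psnd (psnd y)))) (psnd (psnd (psnd (psnd y))))) \<in> set_decode C"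
      by simp
    with R show "justified Or (\<lambda>f. \<exists>t<pfst y. pair t f \<in> set_decode C) C (pfst (psnd y)) (pfst (psnd (psnd y)))
       (pfst (psnd (psnd (psnd y)))) (psnd (psnd (psnd (psnd y))))"
      by blast
  qed
qed

text \<open>\<open>Or\<close>, \<open>Q\<close> and the bound \<open>B\<close> occur only positively
  in \<open>justified\<close>.\<close>

lemma justified_mono:
  assumes "justified Or Q B k e xs v" "\<And>x v. Or x v \<Longrightarrow> Or' x v" "\<And>f. Q f \<Longrightarrow> Q' f" "B \<le> B'"
  shows "justified Or' Q' B' k e xs v"
proof -
  have "Or x v \<longrightarrow> Or' x v" "Q f \<longrightarrow> Q' f" "r < B \<longrightarrow> r < B'" for x v f r
    using assms(2-4) by auto
  then have "justified Or Q B k e xs v \<longrightarrow> justified Or' Q' B' k e xs v"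
    unfolding justified_def by (intro disj_mono conj_mono ex_mono imp_refl)
  then show ?thesis using assms(1) by blast
qed

lemma certificateD:
  "certificate Or C \<Longrightarrow> pair t (claim k e xs v) \<in> set_decode C \<Longrightarrow>
   justified Or (\<lambda>f. \<exists>t'<t. pair t' f \<in> set_decode C) C k e xs v"
  unfolding certificate_iff by blast

lemma certificate_mono: 
  assumes "certificate Or C" "\<And>x v. Or x v \<Longrightarrow> Or' x v" shows "certificate Or' C"
  unfolding certificate_iff
proof (intro allI impI)
  fix t k e xs v assume "pair t (claim k e xs v) \<in> set_decode C"
  from certificateD[OF assms(1) this]
  show "justified Or' (\<lambda>f. \<exists>t'<t. pair t' f \<in> set_decode C) C k e xs v"
    by (rule justified_mono) (use assms(2) in auto)
qed

lemma certifies_mono: 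
  assumes "certifies Or C f" "\<And>x v. Or x v \<Longrightarrow> Or' x v" shows "certifies Or' C f"
  using assms certificate_mono[of Or C Or'] unfolding certifies_def by blast

subsection \<open>Soundness\<close>

text \<open>Quantifying over all programs with code \<open>e\<close> makes claims about numbers that
  code no program vacuously true and avoids an appeal to injectivity of \<open>code\<close>.\<close>

definition true_claim :: "(nat \<Rightarrow> bool) \<Rightarrow> nat \<Rightarrow> nat \<Rightarrow> nat \<Rightarrow> nat \<Rightarrow> bool" where
  "true_claim X k e xs v \<longleftrightarrow>
     (k = 0 \<longrightarrow> (\<forall>p. code p = e \<longrightarrow> ev X p (list_decode xs) v)) \<and>
     (k = 1 \<longrightarrow> (\<forall>gs. list_encode (map code gs) = e \<longrightarrow>
        list_all2 (\<lambda>g y. ev X g (list_decode xs) y) gs (list_decode v))) \<and>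
     (k = 2 \<longrightarrow> (\<forall>p. code p = e \<longrightarrow> (\<forall>z<v. \<exists>u. ev X p (z # list_decode xs) u \<and> u > 0)))"

lemma code_cases:
  "pfst (code p) = 0 \<Longrightarrow> p = Zero"
  "pfst (code p) = 1 \<Longrightarrow> p = Succ"
  "pfst (code p) = 2 \<Longrightarrow> p = Proj (psnd (code p))"
  "pfst (code p) = 3 \<Longrightarrow> p = Orc"
  "pfst (code p) = 4 \<Longrightarrow> \<exists>f gs. p = Comp f gs"
  "pfst (code p) = 5 \<Longrightarrow> \<exists>f g. p = Prec f g"
  "pfst (code p) = 6 \<Longrightarrow> \<exists>f. p = Mn f"
  by (cases p; simp)+

lemma ev_Proj_Suc: "ev X (Proj i) xs v \<Longrightarrow> ev X (Proj (Suc i)) (x # xs) v"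
  using ev_proj[of "Suc i" "x # xs" X] by (auto elim: ev.cases)

lemma ev_Proj_0: "ev X (Proj 0) (x # xs) x"
  using ev_proj[of 0 "x # xs" X] by simp

lemma list_decode_pos: "l > 0 \<Longrightarrow> list_decode l = lhd l # list_decode (ltl l)"
  by (metis lcons_collapse list_decode_lcons)

text \<open>Each disjunct of \<open>justified\<close> mirrors a rule of \<open>ev\<close> or one
  step in checking its list of premises. The tag of \<open>e\<close> fixes the outermost constructor
  of \<open>p\<close>, so the matching rule applies.\<close>

lemma justified_sound:
  assumes j: "justified Or Q B k e xs v" and Or: "\<And>x v. Or x v \<Longrightarrow> v = of_bool (X x)"
    and Q: "\<And>k e xs v. Q (claim k e xs v) \<Longrightarrow> true_claim X k e xs v"
  shows "true_claim X k e xs v"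
proof -
  have Q0: "ev X p (list_decode xs) v" if "Q (claim 0 (code p) xs v)" for p xs v
    using Q[OF that] by (simp add: true_claim_def)
  have Q1: "list_all2 (\<lambda>g y. ev X g (list_decode xs) y) gs (list_decode v)"
    if "Q (claim 1 (list_encode (map code gs)) xs v)" for gs xs v
    using Q[OF that] by (simp add: true_claim_def)
  have Q2: "\<forall>z<v. \<exists>u. ev X p (z # list_decode xs) u \<and> u > 0" if "Q (claim 2 (code p) xs v)" for p xs v
    using Q[OF that] by (simp add: true_claim_def)
  consider "k = 0" | "k = 1" | "k = 2" using j unfolding justified_def by argo
  then show ?thesis
  proof cases
    case 1
    have "ev X p (list_decode xs) v" if p: "code p = e" for p
    proof -
      consider "pfst e = 0" "v = 0"
        | "pfst e = 1" "v > 0" "xs = lcons (v - 1) 0"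
        | "pfst e = 2" "xs > 0" "psnd e = 0" "v = lhd xs"
        | "pfst e = 2" "xs > 0" "psnd e > 0" "Q (claim 0 (pair 2 (psnd e - 1)) (ltl xs) v)"
        | "pfst e = 3" "xs = lcons (lhd xs) 0" "Or (lhd xs) v"
        | ys where "pfst e = 4" "Q (claim 1 (psnd (psnd e)) xs ys)" "Q (claim 0 (pfst (psnd e)) ys v)"
        | "pfst e = 5" "xs > 0" "lhd xs = 0" "Q (claim 0 (pfst (psnd e)) (ltl xs) v)"
        | r where "pfst e = 5" "xs > 0" "lhd xs > 0" "Q (claim 0 e (lcons (lhd xs - 1) (ltl xs)) r)"
            "Q (claim 0 (psnd (psnd e)) (lcons (lhd xs - 1) (lcons r (ltl xs))) v)"
        | "pfst e = 6" "Q (claim 2 (psnd e) xs v)" "Q (claim 0 (psnd e) (lcons v xs) 0)"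
        using j 1 unfolding justified_def by auto
      then show ?thesis
      proof cases
        case 1
        then show ?thesis using code_cases(1)[of p] p by (auto intro: ev_zero)
      next
        case 2
        then show ?thesis using code_cases(2)[of p] p ev_succ[of X "v - 1"] by simp
      next
        case 3
        then show ?thesis using code_cases(3)[of p] p by (simp add: list_decode_pos ev_Proj_0)
      next
        case 4
        then show ?thesis using code_cases(3)[of p] p Q0[of "Proj (psnd e - 1)" "ltl xs" v]
            ev_Proj_Suc[of X "psnd e - 1" "list_decode (ltl xs)" v "lhd xs"]
          by (simp add: list_decode_pos)
      next
        case 5
        have "p = Orc" using code_cases(4)[of p] p 5 by simp
        moreover have "list_decode xs = [lhd xs]"
          by (metis 5(2) list_decode.simps(1) list_decode_lcons)
        moreover have "v = (if X (lhd xs) then 1 else 0)" using Or[OF 5(3)] by simp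
        ultimately show ?thesis by (simp add: ev_orc)
      next
        case 6
        obtain f gs where "p = Comp f gs" using code_cases(5)[of p] p 6 by auto
        then show ?thesis using 6 p Q1[of gs xs ys] Q0[of f ys v] by (auto intro: ev_comp)
      next
        case 7
        obtain f g where "p = Prec f g" using code_cases(6)[of p] p 7 by auto
        then show ?thesis using 7 p Q0[of f "ltl xs" v] by (auto simp: list_decode_pos intro: ev_prec0)
      next
        case 8
        obtain f g where fg: "p = Prec f g" using code_cases(6)[of p] p 8 by auto
        have "list_decode xs = Suc (lhd xs - 1) # list_decode (ltl xs)"
          using 8 by (simp add: list_decode_pos)
        moreover have "ev X p ((lhd xs - 1) # list_decode (ltl xs)) r"
          using Q0[of p "lcons (lhd xs - 1) (ltl xs)" r] 8 p by simp
        moreover have "ev X g ((lhd xs - 1) # r # list_decode (ltl xs)) v"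
          using Q0[of g "lcons (lhd xs - 1) (lcons r (ltl xs))" v] 8 p fg by auto
        ultimately show ?thesis using fg by (auto intro: ev_precS)
      next
        case 9
        obtain f where "p = Mn f" using code_cases(7)[of p] p 9 by auto
        then show ?thesis using 9 p Q0[of f "lcons v xs" 0] Q2[of f xs v] by (auto intro: ev_mn)
      qed
    qed
    then show ?thesis using 1 by (simp add: true_claim_def)
  next
    case 2
    have "list_all2 (\<lambda>g y. ev X g (list_decode xs) y) gs (list_decode v)"
      if gs: "list_encode (map code gs) = e" for gs
    proof (cases gs)
      case Nil
      then show ?thesis using j 2 gs unfolding justified_def by auto
    next
      case (Cons g gs')
      then have e: "e = lcons (code g) (list_encode (map code gs'))" using gs by simp
      then have e0: "e > 0" by (simp del: lcons_simps(4))
      have "v > 0" "Q (claim 0 (lhd e) xs (lhd v))" "Q (claim 1 (ltl e) xs (ltl v))"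
        using j 2 e0 unfolding justified_def by auto
      then show ?thesis using Q0[of g xs "lhd v"] Q1[of gs' xs "ltl v"] Cons
        unfolding e lcons_simps(1,2) by (simp add: list_decode_pos)
    qed
    then show ?thesis using 2 by (simp add: true_claim_def)
  next
    case 3
    have "\<forall>z<v. \<exists>u. ev X p (z # list_decode xs) u \<and> u > 0" if p: "code p = e" for p
    proof (cases "v > 0")
      case True
      then obtain r where r: "Q (claim 2 e xs (v - 1))" "r > 0" "Q (claim 0 e (lcons (v - 1) xs) r)"
        using j 3 unfolding justified_def by auto
      have "ev X p ((v - 1) # list_decode xs) r" using Q0[of p "lcons (v - 1) xs" r] r p by simp
      moreover have "z < v - 1 \<or> z = v - 1" if "z < v" for z using that by linarith
      ultimately show ?thesis using Q2[of p xs "v - 1"] r p by metis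
    qed simp
    then show ?thesis using 3 by (simp add: true_claim_def)
  qed
qed

text \<open>Induction on the stamp: the premises of a claim carry smaller stamps.\<close>

lemma certificate_sound:
  assumes C: "certificate Or C" and Or: "\<And>x v. Or x v \<Longrightarrow> v = of_bool (X x)"
  shows "pair t (claim k e xs v) \<in> set_decode C \<Longrightarrow> true_claim X k e xs v"
proof (induction t arbitrary: k e xs v rule: less_induct)
  case (less t)
  have "justified Or (\<lambda>f. \<exists>t'<t. pair t' f \<in> set_decode C) C k e xs v"
    using C less.prems unfolding certificate_iff by blast
  then show ?case using Or
  proof (rule justified_sound)
    fix k e xs v assume "\<exists>t'<t. pair t' (claim k e xs v) \<in> set_decode C"
    then show "true_claim X k e xs v" using less.IH by blast
  qed
qed

theorem certifies_sound:
  assumes "certifies Or C (claim 0 (code p) (list_encode xs) v)" "\<And>x v. Or x v \<Longrightarrow> v = of_bool (X x)"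
  shows "ev X p xs v"
  using assms certificate_sound[where X = X and k = 0] unfolding certifies_def true_claim_def
  by (metis list_encode_inverse)

subsection \<open>Completeness\<close>

definition certifiable :: "(nat \<Rightarrow> bool) \<Rightarrow> nat \<Rightarrow> bool" where
  "certifiable X f \<longleftrightarrow> (\<exists>s C. certifies (restr X s) C f)"

text \<open>Justifications survive in a larger set by monotonicity, and the code of the union is at
  least each of the two codes, so the bounds do not shrink.\<close>

lemma certificate_Un:
  assumes "certificate Or C" "certificate Or C'"
  shows "certificate Or (set_encode (set_decode C \<union> set_decode C'))" (is "certificate Or ?C")
proof -
  have dec: "set_decode ?C = set_decode C \<union> set_decode C'" by simp
  have le: "C \<le> ?C" "C' \<le> ?C" by (rule subset_decode_imp_le, simp)+
  show ?thesis unfolding certificate_iff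
  proof (intro allI impI)
    fix t k e xs v assume "pair t (claim k e xs v) \<in> set_decode ?C"
    then consider "pair t (claim k e xs v) \<in> set_decode C" | "pair t (claim k e xs v) \<in> set_decode C'"
      unfolding dec by blast
    then show "justified Or (\<lambda>f. \<exists>t'<t. pair t' f \<in> set_decode ?C) ?C k e xs v"
    proof cases
      case 1
      show ?thesis
        by (rule justified_mono[OF certificateD[OF assms(1) 1]]) (use le in auto)
    next
      case 2
      show ?thesis
        by (rule justified_mono[OF certificateD[OF assms(2) 2]]) (use le in auto)
    qed
  qed
qed

lemma restr_mono: "restr X s x v \<Longrightarrow> s \<le> s' \<Longrightarrow> restr X s' x v"
  by (simp add: restr_def)

text \<open>Merges the certificates of several premises into one over a common oracle bound. The
  floor \<open>s0\<close> leaves room for an oracle query in the next step.\<close>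

lemma certifiable_finite:
  assumes "finite Fs" "\<And>f. f \<in> Fs \<Longrightarrow> certifiable X f"
  shows "\<exists>s C. certificate (restr X s) C \<and> s0 \<le> s \<and> (\<forall>f\<in>Fs. \<exists>t. pair t f \<in> set_decode C)"
  using assms
proof (induction Fs)
  case empty
  have "certificate (restr X s0) 0" by (simp add: certificate_def)
  then show ?case by auto
next
  case (insert f Fs)
  from insert obtain s C where C: "certificate (restr X s) C" "s0 \<le> s" "\<forall>f\<in>Fs. \<exists>t. pair t f \<in> set_decode C"
    by auto
  from insert.prems[of f] obtain s' C' t where C': "certificate (restr X s') C'" "pair t f \<in> set_decode C'"
    unfolding certifiable_def certifies_def by auto
  have "certificate (restr X (max s s')) C" "certificate (restr X (max s s')) C'"
    by (rule certificate_mono[OF C(1)] certificate_mono[OF C'(1)], erule restr_mono, simp)+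
  from certificate_Un[OF this] C C' show ?case
    by (intro exI[of _ "max s s'"] exI[of _ "set_encode (set_decode C \<union> set_decode C')"]) fastforce
qed

text \<open>The induction step of completeness: a new claim is put on top of a certificate for its
  finitely many premises \<open>Fs\<close>.\<close>

lemma certifiable_step:
  assumes fin: "finite Fs" and Fs: "\<And>f. f \<in> Fs \<Longrightarrow> certifiable X f"
    and step: "\<And>Q B s. (\<And>f. f \<in> Fs \<Longrightarrow> Q f \<and> f < B) \<Longrightarrow> s0 \<le> s \<Longrightarrow> justified (restr X s) Q B k e xs v"
  shows "certifiable X (claim k e xs v)"
proof -
  obtain s C where C: "certificate (restr X s) C" "s0 \<le> s" and t: "\<And>f. f \<in> Fs \<Longrightarrow> \<exists>t. pair t f \<in> set_decode C"
    using certifiable_finite[OF fin Fs] by blast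
  \<comment> \<open>\<open>C\<close> exceeds every stamp and every claim in its own set, so it is a
    stamp above those of all premises.\<close>
  let ?y = "pair C (claim k e xs v)"
  let ?C = "set_encode (insert ?y (set_decode C))"
  have dec: "set_decode ?C = insert ?y (set_decode C)" by simp
  have le: "C \<le> ?C" by (rule subset_decode_imp_le) auto
  have old: "pair t f \<in> set_decode C \<Longrightarrow> t < C \<and> f < C" for t f
    using mem_set_decode_less[of "pair t f" C] le_pair1[of t f] le_pair2[of f t] by auto
  have "certificate (restr X s) ?C" unfolding certificate_iff
  proof (intro allI impI)
    fix t' k' e' xs' v' assume "pair t' (claim k' e' xs' v') \<in> set_decode ?C"
    then consider "pair t' (claim k' e' xs' v') = ?y" | "pair t' (claim k' e' xs' v') \<in> set_decode C"
      unfolding dec by blast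
    then show "justified (restr X s) (\<lambda>f. \<exists>t<t'. pair t f \<in> set_decode ?C) ?C k' e' xs' v'"
    proof cases
      case 1
      then have eq: "t' = C" "k' = k" "e' = e" "xs' = xs" "v' = v" by (simp_all add: claim_def)
      show ?thesis unfolding eq
      proof (rule step)
        fix f assume "f \<in> Fs"
        from t[OF this] old le show "(\<exists>t<C. pair t f \<in> set_decode ?C) \<and> f < ?C"
          unfolding dec by (meson insertCI less_le_trans)
      qed (rule C(2))
    next
      case 2
      show ?thesis
        by (rule justified_mono[OF certificateD[OF C(1) 2]]) (use le in auto)
    qed
  qed
  moreover have "C < ?C"
    using mem_set_decode_less[of ?y ?C] le_pair1[of C "claim k e xs v"] dec by simp
  ultimately show ?thesis unfolding certifiable_def certifies_def by (metis dec insertI1)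
qed

lemma le_claim: "v \<le> claim k e xs v"
  unfolding claim_def
  by (rule order.trans[OF le_pair2 order.trans[OF le_pair2 le_pair2]])

text \<open>\<open>justified\<close> peels one argument at a time off a projection, hence the
  induction on the index.\<close>

lemma certifiable_Proj:
  "i < length xs \<Longrightarrow> certifiable X (claim 0 (code (Proj i)) (list_encode xs) (xs ! i))"
proof (induction i arbitrary: xs)
  case 0
  then obtain x ys where xs: "xs = x # ys" by (cases xs) auto
  have pos: "list_encode xs > 0" and hd: "lhd (list_encode xs) = x"
    unfolding xs lcons_simps(4)[symmetric] by (simp_all del: lcons_simps(4))
  show ?case
    by (rule certifiable_step[of "{}" X 0]) (use pos hd in \<open>simp_all add: justified_def xs del: list_encode.simps\<close>)
next
  case (Suc i)
  then obtain x ys where xs: "xs = x # ys" by (cases xs) auto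
  have pos: "list_encode xs > 0" and tl: "ltl (list_encode xs) = list_encode ys"
    unfolding xs lcons_simps(4)[symmetric] by (simp_all del: lcons_simps(4))
  have "certifiable X (claim 0 (code (Proj i)) (list_encode ys) (ys ! i))"
    using Suc xs by simp
  then show ?case
    by (intro certifiable_step[of "{claim 0 (code (Proj i)) (list_encode ys) (ys ! i)}" X 0])
      (use pos tl in \<open>simp_all add: justified_def xs del: list_encode.simps\<close>)
qed

lemma certifiable_list:
  assumes "list_all2 (\<lambda>g y. certifiable X (claim 0 (code g) (list_encode xs) y)) gs ys"
  shows "certifiable X (claim 1 (list_encode (map code gs)) (list_encode xs) (list_encode ys))"
  using assms
proof induction
  case Nil
  show ?case by (rule certifiable_step[of "{}" X 0]) (simp_all add: justified_def)
next
  case (Cons g gs y ys)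
  have eq: "list_encode (map code (g # gs)) = lcons (code g) (list_encode (map code gs))"
    "list_encode (y # ys) = lcons y (list_encode ys)" by simp_all
  show ?case unfolding eq
    by (rule certifiable_step[of "{claim 0 (code g) (list_encode xs) y,
        claim 1 (list_encode (map code gs)) (list_encode xs) (list_encode ys)}" X 0])
      (use Cons in \<open>auto simp add: justified_def simp del: lcons_simps(4)\<close>)
qed

theorem certifies_complete:
  assumes "ev X p xs v"
  shows "\<exists>s C. certifies (restr X s) C (claim 0 (code p) (list_encode xs) v)"
proof -
  have "certifiable X (claim 0 (code p) (list_encode xs) v)"
    using assms
  proof induction
    case (ev_zero xs)
    show ?case by (rule certifiable_step[of "{}" X 0]) (simp_all add: justified_def)
  next
    case (ev_succ x)
    have eq: "list_encode [x] = lcons x 0" by (simp add: lcons_def pair_def)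
    show ?case unfolding eq
      by (rule certifiable_step[of "{}" X 0]) (simp_all add: justified_def)
  next
    case (ev_proj i xs)
    then show ?case by (rule certifiable_Proj)
  next
    case (ev_orc x)
    have eq: "list_encode [x] = lcons x 0" by (simp add: lcons_def pair_def)
    \<comment> \<open>The floor \<open>Suc x\<close> ensures that the query at \<open>x\<close> is
      answered.\<close>
    show ?case unfolding eq
      by (rule certifiable_step[of "{}" X "Suc x"]) (simp_all add: justified_def restr_def)
  next
    case (ev_comp xs gs ys f z)
    have "certifiable X (claim 1 (list_encode (map code gs)) (list_encode xs) (list_encode ys))"
      by (rule certifiable_list) (use ev_comp.IH(1) in \<open>auto elim: list_all2_mono\<close>)
    then show ?case using ev_comp.IH(2)
      by (intro certifiable_step[of "{claim 1 (list_encode (map code gs)) (list_encode xs) (list_encode ys),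
          claim 0 (code f) (list_encode ys) z}" X 0])
        (auto simp add: justified_def intro: le_less_trans[OF le_claim])
  next
    case (ev_prec0 f xs z g)
    have eq: "list_encode (0 # xs) = lcons 0 (list_encode xs)" by simp
    show ?case unfolding eq
      by (rule certifiable_step[of "{claim 0 (code f) (list_encode xs) z}" X 0])
        (use ev_prec0 in \<open>auto simp add: justified_def simp del: lcons_simps(4)\<close>)
  next
    case (ev_precS f g n xs r z)
    have eq: "list_encode (Suc n # xs) = lcons (Suc n) (list_encode xs)"
      "list_encode (n # xs) = lcons n (list_encode xs)"
      "list_encode (n # r # xs) = lcons n (lcons r (list_encode xs))"
      by (simp_all only: lcons_simps(4))
    have "\<exists>r<B. Q (claim 0 (code (Prec f g)) (lcons n (list_encode xs)) r) \<and>
        Q (claim 0 (code g) (lcons n (lcons r (list_encode xs))) z)"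
      if "Q (claim 0 (code (Prec f g)) (lcons n (list_encode xs)) r)"
        "claim 0 (code (Prec f g)) (lcons n (list_encode xs)) r < B"
        "Q (claim 0 (code g) (lcons n (lcons r (list_encode xs))) z)" for B Q
      using that le_less_trans[OF le_claim] by blast
    then show ?case using ev_precS.IH unfolding eq
      by (intro certifiable_step[of "{claim 0 (code (Prec f g)) (lcons n (list_encode xs)) r,
          claim 0 (code g) (lcons n (lcons r (list_encode xs))) z}" X 0])
        (auto simp add: justified_def simp del: lcons_simps(4))
  next
    case (ev_mn f y xs)
    have eq: "list_encode (z # xs) = lcons z (list_encode xs)" for z by simp
    \<comment> \<open>Claims of kind 2 are built up one value at a time, up to the result
      \<open>y\<close>.\<close>
    have "certifiable X (claim 2 (code f) (list_encode xs) u)" if "u \<le> y" for u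
      using that
    proof (induction u)
      case 0
      show ?case by (rule certifiable_step[of "{}" X 0]) (simp_all add: justified_def)
    next
      case (Suc u)
      then obtain r where r: "r > 0" "certifiable X (claim 0 (code f) (lcons u (list_encode xs)) r)"
        using ev_mn.IH(2) unfolding eq by (metis Suc_le_eq)
      have "\<exists>r<B. r > 0 \<and> Q (claim 0 (code f) (lcons u (list_encode xs)) r)"
        if "Q (claim 0 (code f) (lcons u (list_encode xs)) r)"
          "claim 0 (code f) (lcons u (list_encode xs)) r < B" for B Q
        using that le_less_trans[OF le_claim] r by blast
      with r Suc show ?case
        by (intro certifiable_step[of "{claim 0 (code f) (lcons u (list_encode xs)) r,
          claim 2 (code f) (list_encode xs) u}" X 0])
        (auto simp add: justified_def simp del: lcons_simps(4))
    qed
    then show ?case using ev_mn.IH(1) unfolding eq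
      by (intro certifiable_step[of "{claim 2 (code f) (list_encode xs) y,
          claim 0 (code f) (lcons y (list_encode xs)) 0}" X 0])
        (auto simp add: justified_def simp del: lcons_simps(4))
  qed
  then show ?thesis by (simp add: certifiable_def)
qed

subsection \<open>Checking certificates is computable\<close>

lemma computable_lcons: "computable f \<Longrightarrow> computable g \<Longrightarrow> computable (\<lambda>X x. lcons (f X x) (g X x))"
  and computable_lhd: "computable f \<Longrightarrow> computable (\<lambda>X x. lhd (f X x))"
  and computable_ltl: "computable f \<Longrightarrow> computable (\<lambda>X x. ltl (f X x))"
  unfolding lcons_def lhd_def ltl_def by (intro computable_intros; assumption)+

lemma computable_claim:
  "computable k \<Longrightarrow> computable e \<Longrightarrow> computable xs \<Longrightarrow> computable v \<Longrightarrow>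
   computable (\<lambda>X x. claim (k X x) (e X x) (xs X x) (v X x))"
  unfolding claim_def by (intro computable_intros)

text \<open>The two coded sets will be the stem of a requirement and a candidate extension of
  it.\<close>

lemma decidable_certifies:
  assumes "computable s" "computable F" "computable D" "computable C" "computable f"
  shows "decidable (\<lambda>X x. certifies (restr (\<lambda>k. k \<in> set_decode (F X x) \<or> k \<in> set_decode (D X x)) (s X x)) (C X x) (f X x))"
proof -
  have of_bool_iff: "v = of_bool P \<longleftrightarrow> P \<and> v = 1 \<or> \<not> P \<and> v = 0" for v :: nat and P by auto
  show ?thesis
    unfolding certifies_def certificate_def justified_def restr_def of_bool_iff
    by (intro computable_intros computable_lcons computable_lhd computable_ltl computable_claim
      assms[THEN computable_compose])
qed

section \<open>The construction\<close>

text \<open>The number entering the set at stage \<open>s\<close> codes the whole history that matters: \<open>s\<close> itself, the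
  oracle below \<open>s\<close>, a position on the current approximation to the true path, and the set of all
  numbers currently kept. Hence an element of the set tells which earlier numbers were kept when it entered.\<close>

definition stage :: "nat \<Rightarrow> nat" where "stage n = pfst n"
definition bits :: "nat \<Rightarrow> nat" where "bits n = pfst (psnd n)"
definition pos :: "nat \<Rightarrow> nat" where "pos n = pfst (psnd (psnd n))"
definition alive :: "nat \<Rightarrow> nat" where "alive n = psnd (psnd (psnd n))"

text \<open>A position carries a padding, a label and a requirement. Requirement \<open>0\<close> is void, and
  \<open>Suc (pair e (pair F q))\<close> asks to diagonalise against the program \<open>e\<close> on oracles that extend \<open>F\<close>
  by elements with labels above \<open>q\<close>.\<close>

definition label :: "nat \<Rightarrow> nat" where "label n = pfst (psnd (pos n))"
definition req :: "nat \<Rightarrow> nat" where "req n = psnd (psnd (pos n))"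
definition req_prog :: "nat \<Rightarrow> nat" where "req_prog n = pfst (req n - 1)"
definition req_stem :: "nat \<Rightarrow> nat" where "req_stem n = pfst (psnd (req n - 1))"
definition req_bound :: "nat \<Rightarrow> nat" where "req_bound n = psnd (psnd (req n - 1))"

text \<open>With \<open>Y (pair e d)\<close> read as \<open>e \<le> d\<close> in a linear order,
  this says that the largest element on which the coded sets differ belongs to \<open>Q\<close>.
  \<open>Y\<close> occurs only positively, so a comparison verified from the recorded oracle bits
  remains correct.\<close>

definition label_less :: "(nat \<Rightarrow> bool) \<Rightarrow> nat \<Rightarrow> nat \<Rightarrow> bool" where
  "label_less Y P Q \<longleftrightarrow> (\<exists>d<Q. d \<in> set_decode Q \<and> d \<notin> set_decode P \<and>
     (\<forall>e<P. e \<in> set_decode P \<and> e \<notin> set_decode Q \<longrightarrow> Y (pair e d)))"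

lemma label_less_iff:
  "label_less Y P Q \<longleftrightarrow> (\<exists>d\<in>set_decode Q - set_decode P. \<forall>e\<in>set_decode P - set_decode Q. Y (pair e d))"
  unfolding label_less_def by (auto dest: mem_set_decode_less)

lemma label_less_mono: "label_less Y P Q \<Longrightarrow> (\<And>k. Y k \<Longrightarrow> Z k) \<Longrightarrow> label_less Z P Q"
  unfolding label_less_iff by blast

definition descending :: "(nat \<Rightarrow> bool) \<Rightarrow> nat set \<Rightarrow> bool" where
  "descending Y G \<longleftrightarrow> (\<forall>x\<in>G. \<forall>y\<in>G. stage x < stage y \<longrightarrow> label_less Y (label y) (label x))"

abbreviation known :: "nat \<Rightarrow> nat \<Rightarrow> bool" where
  "known n \<equiv> \<lambda>k. k \<in> set_decode (bits n)"

text \<open>\<open>D\<close> and \<open>C\<close> witness that the program of \<open>b\<close>, run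
  on the stem extended by \<open>D\<close>, puts \<open>b\<close> into the set. The members of
  \<open>D\<close> are void and later than \<open>b\<close>, so that they can be rescued when
  \<open>b\<close> is removed. The quantifiers are bounded for decidability;
  \<open>threat_by_iff\<close> removes the bounds.\<close>

definition threat_by :: "nat \<Rightarrow> nat \<Rightarrow> nat \<Rightarrow> nat \<Rightarrow> bool" where
  "threat_by n b D C \<longleftrightarrow> b \<in> set_decode (alive n) \<and> 0 < req b \<and>
     (\<forall>d<D. d \<in> set_decode D \<longrightarrow> d \<in> set_decode (alive n) \<and> req d = 0 \<and> stage b < stage d \<and>
        label_less (known n) (req_bound b) (label d)) \<and>
     (\<forall>x<req_stem b + D. \<forall>y<req_stem b + D.
        (x \<in> set_decode (req_stem b) \<or> x \<in> set_decode D) \<and>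
        (y \<in> set_decode (req_stem b) \<or> y \<in> set_decode D) \<and> stage x < stage y \<longrightarrow>
        label_less (known n) (label y) (label x)) \<and>
     certifies (restr (\<lambda>k. k \<in> set_decode (req_stem b) \<or> k \<in> set_decode D) (stage n)) C
       (claim 0 (req_prog b) (lcons b 0) 1)"

lemma threat_by_iff:
  "threat_by n b D C \<longleftrightarrow> b \<in> set_decode (alive n) \<and> 0 < req b \<and>
     (\<forall>d\<in>set_decode D. d \<in> set_decode (alive n) \<and> req d = 0 \<and> stage b < stage d \<and>
        label_less (known n) (req_bound b) (label d)) \<and>
     descending (known n) (set_decode (req_stem b) \<union> set_decode D) \<and>
     certifies (restr (\<lambda>k. k \<in> set_decode (req_stem b) \<union> set_decode D) (stage n)) C
       (claim 0 (req_prog b) (lcons b 0) 1)"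
proof -
  have "x < req_stem b + D" if "x \<in> set_decode (req_stem b) \<or> x \<in> set_decode D" for x
    using that mem_set_decode_less[of x "req_stem b"] mem_set_decode_less[of x D] by auto
  then have "descending (known n) (set_decode (req_stem b) \<union> set_decode D) \<longleftrightarrow>
     (\<forall>x<req_stem b + D. \<forall>y<req_stem b + D.
        (x \<in> set_decode (req_stem b) \<or> x \<in> set_decode D) \<and>
        (y \<in> set_decode (req_stem b) \<or> y \<in> set_decode D) \<and> stage x < stage y \<longrightarrow>
        label_less (known n) (label y) (label x))"
    unfolding descending_def Un_iff Ball_def by blast
  moreover have "(\<forall>d\<in>set_decode D. P d) \<longleftrightarrow> (\<forall>d<D. d \<in> set_decode D \<longrightarrow> P d)" for P
    by (auto dest: mem_set_decode_less)
  ultimately show ?thesis unfolding threat_by_def by simp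
qed

definition threat :: "nat \<Rightarrow> nat \<Rightarrow> bool" where
  "threat n w \<longleftrightarrow> threat_by n (pfst w) (pfst (psnd w)) (psnd (psnd w))"

text \<open>The alternative \<open>w = stage n\<close> makes the search total and stands for
  inaction. A threat is eligible only once the stage exceeds its code.\<close>

definition response :: "nat \<Rightarrow> nat" where
  "response n = (LEAST w. threat n w \<or> w = stage n)"

definition acts :: "nat \<Rightarrow> bool" where "acts n \<longleftrightarrow> response n < stage n"
definition target :: "nat \<Rightarrow> nat" where "target n = pfst (response n)"
definition saved :: "nat \<Rightarrow> nat" where "saved n = pfst (psnd (response n))"

text \<open>An action returns to just after the position of the victim and discards everything from
  the victim on except the saved numbers. The bound \<open>Suc n\<close> loses nothing, as the
  members of the set coded by \<open>alive n\<close> are smaller than \<open>n\<close>.\<close>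

definition step :: "nat \<Rightarrow> bool \<Rightarrow> nat" where
  "step n a = pair (Suc (stage n)) (pair (if a then bits n + 2 ^ stage n else bits n)
     (pair (Suc (pos (if acts n then target n else n)))
       (set_encode {k. k < Suc n \<and> (acts n \<and> (k \<in> set_decode (alive n) \<and> stage k < stage (target n) \<or>
           k \<in> set_decode (saved n)) \<or> \<not> acts n \<and> (k \<in> set_decode (alive n) \<or> k = n))})))"

definition node :: "(nat \<Rightarrow> bool) \<Rightarrow> nat \<Rightarrow> nat" where
  "node X s = rec_nat (pair 0 (pair 0 (pair 0 0))) (\<lambda>s n. step n (X s)) s"

lemma node_0: "node X 0 = pair 0 (pair 0 (pair 0 0))"
  and node_Suc: "node X (Suc s) = step (node X s) (X s)"
  by (simp_all add: node_def)

definition kept :: "(nat \<Rightarrow> bool) \<Rightarrow> nat \<Rightarrow> nat set" where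
  "kept X s = set_decode (alive (node X s))"

text \<open>A number \<open>b\<close> can enter only at \<open>stage b\<close>, which is at most
  \<open>b\<close>. So the stages beyond \<open>b\<close> decide permanence, and a number that never
  enters is already absent at \<open>Suc b\<close>.\<close>

definition lim_set :: "(nat \<Rightarrow> bool) \<Rightarrow> nat set" where
  "lim_set X = {b. \<forall>s>b. b \<in> kept X s}"

subsection \<open>Computability of the construction\<close>

lemma computable_stage: "computable f \<Longrightarrow> computable (\<lambda>X x. stage (f X x))"
  and computable_bits: "computable f \<Longrightarrow> computable (\<lambda>X x. bits (f X x))"
  and computable_pos: "computable f \<Longrightarrow> computable (\<lambda>X x. pos (f X x))"
  and computable_alive: "computable f \<Longrightarrow> computable (\<lambda>X x. alive (f X x))"
  unfolding stage_def bits_def pos_def alive_def by (intro computable_intros; assumption)+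

lemma computable_label: "computable f \<Longrightarrow> computable (\<lambda>X x. label (f X x))"
  and computable_req: "computable f \<Longrightarrow> computable (\<lambda>X x. req (f X x))"
  unfolding label_def req_def by (intro computable_intros computable_pos; assumption)+

lemma computable_req_parts:
  "computable f \<Longrightarrow> computable (\<lambda>X x. req_prog (f X x))"
  "computable f \<Longrightarrow> computable (\<lambda>X x. req_stem (f X x))"
  "computable f \<Longrightarrow> computable (\<lambda>X x. req_bound (f X x))"
  unfolding req_prog_def req_stem_def req_bound_def by (intro computable_intros computable_req; assumption)+

lemmas computable_node_intros = computable_stage computable_bits computable_pos computable_alive
  computable_label computable_req computable_req_parts

lemma decidable_label_less:
  assumes "computable n" "computable P" "computable Q"
  shows "decidable (\<lambda>X x. label_less (known (n X x)) (P X x) (Q X x))"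
  unfolding label_less_def
  by (intro computable_intros computable_node_intros assms[THEN computable_compose])

lemma decidable_threat_by:
  assumes "computable n" "computable b" "computable D" "computable C"
  shows "decidable (\<lambda>X x. threat_by (n X x) (b X x) (D X x) (C X x))"
  unfolding threat_by_def
  by (intro computable_intros computable_node_intros decidable_label_less decidable_certifies
      computable_claim computable_lcons assms[THEN computable_compose])

lemma computable_response:
  assumes "computable n"
  shows "computable (\<lambda>X x. response (n X x))"
  unfolding response_def threat_def
  by (rule computable_Least)
    (intro computable_intros computable_node_intros decidable_threat_by assms[THEN computable_compose], blast)

lemma computable_step:
  assumes "computable n" "decidable P"
  shows "computable (\<lambda>X x. step (n X x) (P X x))"
  unfolding step_def acts_def target_def saved_def
  by (intro computable_intros computable_node_intros computable_response
      assms(1)[THEN computable_compose] assms(2)[THEN decidable_compose])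

lemma computable_node:
  assumes "computable f"
  shows "computable (\<lambda>X x. node X (f X x))"
  unfolding node_def
  by (intro computable_intros computable_step assms[THEN computable_compose])

lemma complement_lim_set_ce: "\<exists>p. \<forall>X. - dom_rel X p = lim_set X"
proof -
  have "decidable (\<lambda>X z. pfst z < psnd z \<and> pfst z \<notin> set_decode (alive (node X (psnd z))))"
    by (intro computable_intros computable_node_intros computable_node)
  then obtain p where p: "\<And>X b s. ev X p [b] s \<longleftrightarrow> (b < s \<and> b \<notin> set_decode (alive (node X s))) \<and>
      (\<forall>y<s. \<not> (b < y \<and> b \<notin> set_decode (alive (node X y))))"
    using ev_Mn_decidable[of "\<lambda>X b s. b < s \<and> b \<notin> set_decode (alive (node X s))"] by blast
  have "- dom_rel X p = lim_set X" for X
    unfolding dom_rel_def lim_set_def kept_def p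
    using exists_least_iff[of "\<lambda>s. _ < s \<and> _ \<notin> set_decode (alive (node X s))"] by blast
  then show ?thesis by blast
qed

subsection \<open>Stages\<close>

lemma step_simps:
  "stage (step n a) = Suc (stage n)"
  "bits (step n a) = (if a then bits n + 2 ^ stage n else bits n)"
  "pos (step n a) = Suc (pos (if acts n then target n else n))"
  by (simp_all add: step_def stage_def bits_def pos_def)

lemma stage_node [simp]: "stage (node X s) = s"
  by (induction s) (simp_all add: node_0 node_Suc step_simps, simp add: stage_def)

lemma node_eq_iff [simp]: "node X s = node X t \<longleftrightarrow> s = t"
  by (metis stage_node)

lemma stage_le: "stage n \<le> n"
  by (simp add: stage_def pfst_le)

lemma known_node: "set_decode (bits (node X s)) = {k. k < s \<and> X k}"
proof (induction s)
  case 0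
  show ?case by (simp add: node_0 bits_def)
next
  case (Suc s)
  have "s \<notin> set_decode (bits (node X s))" by (simp add: Suc)
  then have "set_decode (bits (node X s) + 2 ^ s) = insert s (set_decode (bits (node X s)))"
    using set_decode_plus_power_2[of s "bits (node X s)"] by (simp add: add.commute)
  then show ?case by (auto simp: node_Suc step_simps Suc less_Suc_eq)
qed

lemma label_less_known: "label_less (known (node X s)) P Q \<Longrightarrow> label_less X P Q"
  by (erule label_less_mono) (simp add: known_node)

lemma descending_known: "descending (known (node X s)) G \<Longrightarrow> descending X G"
  unfolding descending_def using label_less_known by blast

text \<open>One comparison involves finitely many oracle bits, all of them recorded from some stage
  on.\<close>

lemma label_less_eventually_known:
  assumes "label_less X P Q"
  shows "\<forall>\<^sub>F s in sequentially. label_less (known (node X s)) P Q"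
proof -
  obtain d where d: "d \<in> set_decode Q - set_decode P" "\<forall>e\<in>set_decode P - set_decode Q. X (pair e d)"
    using assms unfolding label_less_iff by blast
  have "\<forall>\<^sub>F s in sequentially. \<forall>e\<in>set_decode P. pair e d < s"
    by (intro eventually_ball_finite ballI eventually_gt_at_top) simp
  then show ?thesis
    by eventually_elim (use d in \<open>auto simp: label_less_iff known_node intro!: bexI[of _ d]\<close>)
qed

lemma response_threat: "acts n \<Longrightarrow> threat n (response n)"
  using LeastI[of "\<lambda>w. threat n w \<or> w = stage n" "stage n"] unfolding acts_def response_def by auto

lemma acts_threat_by: "acts n \<Longrightarrow> threat_by n (target n) (saved n) (psnd (psnd (response n)))"
  using response_threat unfolding threat_def target_def saved_def .

lemma kept_0 [simp]: "kept X 0 = {}"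
  by (simp add: kept_def node_0 alive_def)

abbreviation acting :: "(nat \<Rightarrow> bool) \<Rightarrow> nat \<Rightarrow> bool" where "acting X s \<equiv> acts (node X s)"
abbreviation victim :: "(nat \<Rightarrow> bool) \<Rightarrow> nat \<Rightarrow> nat" where "victim X s \<equiv> target (node X s)"
abbreviation rescued :: "(nat \<Rightarrow> bool) \<Rightarrow> nat \<Rightarrow> nat set" where
  "rescued X s \<equiv> set_decode (saved (node X s))"

lemma acting_facts:
  assumes "acting X s"
  shows "victim X s \<in> kept X s" "0 < req (victim X s)"
    "d \<in> rescued X s \<Longrightarrow> d \<in> kept X s \<and> req d = 0 \<and> stage (victim X s) < stage d \<and>
       label_less X (req_bound (victim X s)) (label d)"
    "descending X (set_decode (req_stem (victim X s)) \<union> rescued X s)"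
    "\<exists>C. certifies (restr (\<lambda>k. k \<in> set_decode (req_stem (victim X s)) \<union> rescued X s) s) C
       (claim 0 (req_prog (victim X s)) (lcons (victim X s) 0) 1)"
  using acts_threat_by[OF assms] label_less_known descending_known
  unfolding threat_by_iff kept_def stage_node by blast+

lemma kept_Suc:
  "kept X (Suc s) = (if acting X s then {k \<in> kept X s. stage k < stage (victim X s)} \<union> rescued X s
     else insert (node X s) (kept X s))"
proof -
  let ?n = "node X s"
  have alive: "k < Suc ?n" if "k \<in> kept X s" for k
    using mem_set_decode_less[of k "alive ?n"] that psnd_le[of ?n] psnd_le[of "psnd ?n"]
      psnd_le[of "psnd (psnd ?n)"]
    unfolding kept_def alive_def by linarith
  have "kept X (Suc s) = {k. k < Suc ?n \<and> (acts ?n \<and> (k \<in> kept X s \<and> stage k < stage (target ?n) \<or>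
           k \<in> set_decode (saved ?n)) \<or> \<not> acts ?n \<and> (k \<in> kept X s \<or> k = ?n))}"
    by (simp add: kept_def node_Suc step_def alive_def)
  then show ?thesis
    using alive acting_facts(3)[of X s] by auto
qed

lemma kept_stage: "k \<in> kept X s \<Longrightarrow> k = node X (stage k) \<and> stage k < s"
proof (induction s)
  case (Suc s)
  show ?case
  proof (cases "k \<in> kept X s")
    case True
    then show ?thesis using Suc.IH by auto
  next
    case False
    then have "k = node X s"
      using Suc.prems acting_facts(3)[of X s k] unfolding kept_Suc by (auto split: if_splits)
    then show ?thesis by simp
  qed
qed simp

text \<open>Numbers enter only at their own stage and an action rescues only numbers still kept, so
  a loss is final.\<close>

lemma kept_antimono: "k \<in> kept X s' \<Longrightarrow> stage k < s \<Longrightarrow> s \<le> s' \<Longrightarrow> k \<in> kept X s"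
proof (induction s')
  case (Suc s')
  show ?case
  proof (cases "s = Suc s'")
    case False
    then have "s \<le> s'" using Suc.prems by simp
    moreover have "k \<in> kept X s'"
      using Suc.prems \<open>s \<le> s'\<close> acting_facts(3)[of X s' k] unfolding kept_Suc by (auto split: if_splits)
    ultimately show ?thesis using Suc by blast
  qed (use Suc in simp)
qed simp

lemma lim_set_iff: "k \<in> lim_set X \<longleftrightarrow> k = node X (stage k) \<and> (\<forall>s>stage k. k \<in> kept X s)"
proof
  assume k: "k \<in> lim_set X"
  then have k': "k \<in> kept X (Suc k)" by (simp add: lim_set_def)
  have "k \<in> kept X s" if "stage k < s" for s
  proof (cases "s \<le> k")
    case True
    then show ?thesis using kept_antimono[OF k' that] by simp
  qed (use k in \<open>simp add: lim_set_def\<close>)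
  then show "k = node X (stage k) \<and> (\<forall>s>stage k. k \<in> kept X s)" using kept_stage[OF k'] by blast
next
  assume "k = node X (stage k) \<and> (\<forall>s>stage k. k \<in> kept X s)"
  then show "k \<in> lim_set X" using stage_le[of k] by (auto simp: lim_set_def)
qed

lemma inj_on_stage: "S \<subseteq> lim_set X \<Longrightarrow> inj_on stage S"
  by (metis inj_onI lim_set_iff subsetD)

text \<open>Only actions remove numbers, and only such as entered no earlier than the victim;
  \<open>r\<close> is the stage of the first loss.\<close>

lemma kept_lost:
  assumes "k \<in> kept X s" "k \<notin> kept X s'" "s \<le> s'"
  shows "\<exists>r\<ge>s. acting X r \<and> k \<in> kept X r \<and> stage (victim X r) \<le> stage k \<and> k \<notin> kept X (Suc r)"
proof -
  define r where "r = (LEAST r. s \<le> r \<and> k \<notin> kept X (Suc r))"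
  have "s' \<noteq> s" using assms by blast
  then have "s < s'" using assms(3) by simp
  then have "s \<le> s' - 1 \<and> k \<notin> kept X (Suc (s' - 1))" using assms(2) by simp
  then have r: "s \<le> r" "k \<notin> kept X (Suc r)"
    unfolding r_def by (metis (mono_tags, lifting) LeastI)+
  have "k \<in> kept X r"
  proof (cases "r = s")
    case False
    then obtain u where u: "r = Suc u" "s \<le> u" using r(1) by (metis le_antisym not0_implies_Suc not_less_eq_eq le_zero_eq)
    then have "\<not> (s \<le> u \<and> k \<notin> kept X (Suc u))"
      using not_less_Least[of u "\<lambda>r. s \<le> r \<and> k \<notin> kept X (Suc r)"] unfolding r_def by simp
    then show ?thesis using u by simp
  qed (use assms in simp)
  then show ?thesis
    using r unfolding kept_Suc by (intro exI[of _ r]) (auto split: if_splits)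
qed

text \<open>When a number is lost, the later survivors are descending. So two later elements of the limit set
  with non-decreasing labels rule out that a number still kept is lost.\<close>

lemma kept_secure:
  assumes b: "b \<in> kept X s" and m: "m \<in> lim_set X" and n: "n \<in> lim_set X"
    and st: "stage b < stage m" "stage m < stage n" "stage n < s"
    and nless: "\<not> label_less X (label n) (label m)"
  shows "b \<in> lim_set X"
proof (rule ccontr)
  assume "b \<notin> lim_set X"
  then obtain s' where s': "stage b < s'" "b \<notin> kept X s'"
    using kept_stage[OF b] by (auto simp: lim_set_iff)
  have "s \<le> s'" using kept_antimono[OF b s'(1)] s'(2) by (meson nle_le)
  from kept_lost[OF b s'(2) this] obtain r where
    r: "s \<le> r" "acting X r" "stage (victim X r) \<le> stage b" by blast
  have "m \<in> kept X (Suc r)" "n \<in> kept X (Suc r)"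
    using m n st r by (auto simp: lim_set_iff)
  then have "m \<in> rescued X r" "n \<in> rescued X r"
    using r st unfolding kept_Suc by auto
  then show False using acting_facts(4)[OF r(2)] st nless unfolding descending_def by blast
qed

subsection \<open>True stages\<close>

lemma pos_node_Suc: "pos (node X (Suc s)) = Suc (pos (if acting X s then victim X s else node X s))"
  by (simp add: node_Suc step_simps)

text \<open>An action leaves only void numbers beyond its victim and resets the position to just
  above that of the victim. Without an action, the new number takes the current position, which
  exceeds those of all older nonvoid ones.\<close>

lemma pos_order:
  "k \<in> kept X s \<Longrightarrow> 0 < req k \<Longrightarrow> pos k < pos (node X s) \<and>
     (\<forall>k'\<in>kept X s. 0 < req k' \<and> stage k' < stage k \<longrightarrow> pos k' < pos k)"
proof (induction s arbitrary: k)
  case (Suc s)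
  show ?case
  proof (cases "acting X s")
    case True
    have old: "k' \<in> kept X s \<and> stage k' < stage (victim X s)" if "k' \<in> kept X (Suc s)" "0 < req k'" for k'
      using that True acting_facts(3)[OF True, of k'] unfolding kept_Suc by auto
    have "pos k < pos (victim X s)"
      using Suc.IH[OF acting_facts(1,2)[OF True]] old[OF Suc.prems] Suc.prems by blast
    then show ?thesis
      using Suc.IH[of k] old Suc.prems True by (auto simp: pos_node_Suc)
  next
    case False
    then have "k = node X s \<or> k \<in> kept X s" using Suc.prems unfolding kept_Suc by auto
    then show ?thesis
    proof
      assume "k = node X s"
      then show ?thesis using Suc.IH False by (auto simp: pos_node_Suc kept_Suc)
    next
      assume "k \<in> kept X s"
      then show ?thesis using Suc.IH[of k] Suc.prems False kept_stage[of k X s]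
        by (auto simp: pos_node_Suc kept_Suc)
    qed
  qed
qed simp

text \<open>The survivors of an action either entered before the victim or are rescued, and the
  rescued ones entered after it.\<close>

lemma victim_lost:
  assumes "acting X s" "s < s'"
  shows "victim X s \<notin> kept X s'"
proof
  assume "victim X s \<in> kept X s'"
  then have "victim X s \<in> kept X (Suc s)"
    using kept_antimono[of "victim X s" X s' "Suc s"] kept_stage acting_facts(1)[OF assms(1)] assms(2)
    by (meson Suc_leI less_Suc_eq)
  then show False using acting_facts(3)[OF assms(1), of "victim X s"] assms(1) by (auto simp: kept_Suc)
qed

text \<open>The last visit to position \<open>i\<close>, after which the path stays strictly above
  it: the analogue of a true stage of an enumeration.\<close>

definition true_stage :: "(nat \<Rightarrow> bool) \<Rightarrow> nat \<Rightarrow> nat \<Rightarrow> bool" where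
  "true_stage X i t \<longleftrightarrow> pos (node X t) = i \<and> (\<forall>s>t. i < pos (node X s))"

context
  fixes X i t
  assumes true: "true_stage X i t"
begin

text \<open>An action would reset the position to at most \<open>i\<close>.\<close>

lemma not_acting_true: "\<not> acting X t"
proof
  assume a: "acting X t"
  then have "pos (victim X t) < pos (node X t)" using pos_order acting_facts(1,2) by blast
  moreover have "i < pos (node X (Suc t))" using true by (simp add: true_stage_def)
  ultimately show False using a true by (simp add: pos_node_Suc true_stage_def)
qed

lemma true_in_kept_Suc: "node X t \<in> kept X (Suc t)"
  using not_acting_true by (simp add: kept_Suc)

text \<open>A victim older than \<open>t\<close> was already kept at \<open>t\<close>, so its
  position is below \<open>i\<close>, and its removal would bring the path back to at most
  \<open>i\<close>.\<close>

lemma victim_after_true: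
  assumes "t < s" "acting X s"
  shows "victim X s = node X t \<or> t < stage (victim X s)"
proof -
  have v: "victim X s \<in> kept X s" "0 < req (victim X s)" using acting_facts assms by blast+
  have "i < pos (node X (Suc s))" using true assms by (simp add: true_stage_def)
  then have pos: "i \<le> pos (victim X s)" using assms by (simp add: pos_node_Suc)
  have "\<not> stage (victim X s) < t"
  proof
    assume "stage (victim X s) < t"
    then have "victim X s \<in> kept X t" using kept_antimono[OF v(1)] assms by simp
    then show False using pos_order[of "victim X s" X t] v pos true by (simp add: true_stage_def)
  qed
  then show ?thesis using kept_stage[OF v(1)] by (metis linorder_neqE_nat)
qed

lemma victim_true_unique:
  "acting X s \<Longrightarrow> victim X s = node X t \<Longrightarrow> s < s' \<Longrightarrow> acting X s' \<Longrightarrow> victim X s' \<noteq> node X t"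
  using victim_lost acting_facts(1) by metis

text \<open>The path is at \<open>Suc i\<close> for the last time right after \<open>u\<close>,
  which is \<open>t\<close> itself or the stage at which \<open>node X t\<close> falls victim. The
  latter happens at most once, and later actions have victims beyond \<open>t\<close>.\<close>

lemma next_true_stage: "\<exists>t'. true_stage X (Suc i) t'"
proof -
  obtain u where u: "t \<le> u" "pos (node X (Suc u)) = Suc i"
    "\<And>s. u < s \<Longrightarrow> acting X s \<Longrightarrow> victim X s \<noteq> node X t"
  proof (cases "\<exists>s>t. acting X s \<and> victim X s = node X t")
    case True
    then obtain s where "t < s" "acting X s" "victim X s = node X t" by blast
    then show ?thesis using true victim_true_unique[of s]
      by (intro that[of s]) (auto simp: pos_node_Suc true_stage_def)
  next
    case False
    show ?thesis
    proof (rule that[of t])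
      show "pos (node X (Suc t)) = Suc i"
        using true not_acting_true by (simp add: pos_node_Suc true_stage_def)
      show "victim X s \<noteq> node X t" if "t < s" "acting X s" for s
        using False that by blast
    qed simp
  qed
  have "Suc i < pos (node X s)" if s: "Suc u < s" for s
  proof -
    obtain r where r: "s = Suc r" "u < r" using s by (cases s) auto
    have "i < pos (if acting X r then victim X r else node X r)"
    proof (cases "acting X r")
      case True
      have "victim X r \<noteq> node X t" "t < r" using u True r by auto
      then have "t < stage (victim X r)" using victim_after_true[of r] True by blast
      then show ?thesis using True true kept_stage[OF acting_facts(1)[OF True]] unfolding true_stage_def by metis
    qed (use true u r in \<open>auto simp: true_stage_def\<close>)
    then show ?thesis by (simp add: r pos_node_Suc)
  qed
  then show ?thesis using u unfolding true_stage_def by blast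
qed

lemma true_not_acting_in_lim_set:
  assumes "\<And>s. t < s \<Longrightarrow> acting X s \<Longrightarrow> victim X s \<noteq> node X t"
  shows "node X t \<in> lim_set X"
proof (rule ccontr)
  assume "node X t \<notin> lim_set X"
  then obtain s where "t < s" "node X t \<notin> kept X s" by (auto simp: lim_set_iff)
  from kept_lost[OF true_in_kept_Suc this(2)] this(1) obtain r where
    "t < r" "acting X r" "stage (victim X r) \<le> t" by (metis Suc_le_eq stage_node)
  then show False using assms victim_after_true[of r] by force
qed

lemma true_void_in_lim_set:
  assumes "req (node X t) = 0"
  shows "node X t \<in> lim_set X"
  using assms acting_facts(2) by (intro true_not_acting_in_lim_set) fastforce

text \<open>A later victim that could take \<open>d\<close> with it would have entered between
  \<open>t\<close> and \<open>s\<close>, so it would have survived the action at \<open>s\<close> as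
  a rescued number. But rescued numbers are void and never victims.\<close>

lemma true_acting_rescued:
  assumes "t < s" "acting X s" "victim X s = node X t"
  shows "rescued X s \<subseteq> lim_set X"
proof
  fix d assume d: "d \<in> rescued X s"
  then have dk: "d \<in> kept X s" and dS: "d \<in> kept X (Suc s)"
    using acting_facts(3)[OF assms(2)] assms(2) by (auto simp: kept_Suc)
  show "d \<in> lim_set X"
  proof (rule ccontr)
    assume "d \<notin> lim_set X"
    then obtain s' where s': "stage d < s'" "d \<notin> kept X s'" using kept_stage[OF dk] by (auto simp: lim_set_iff)
    have "Suc s \<le> s'" using kept_antimono[OF dS s'(1)] s'(2) by (meson nle_le)
    from kept_lost[OF dS s'(2) this] obtain r where
      r: "s < r" "acting X r" "stage (victim X r) \<le> stage d" by (metis Suc_le_eq)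
    have st: "t < stage (victim X r)"
      using victim_after_true[of r] victim_true_unique[OF assms(2,3) r(1,2)] r assms by auto
    have "stage (victim X r) < Suc s" using r(3) kept_stage[OF dk] by simp
    then have "victim X r \<in> kept X (Suc s)"
      using kept_antimono[OF acting_facts(1)[OF r(2)]] r(1) by simp
    then have "victim X r \<in> rescued X s" using st assms by (auto simp: kept_Suc)
    then show False using acting_facts(3)[OF assms(2)] acting_facts(2)[OF r(2)] by auto
  qed
qed

end

lemma ex_true_stage: "\<exists>t. true_stage X i t"
proof (induction i)
  case 0
  have "0 < pos (node X s)" if "0 < s" for s
    using that by (cases s) (simp_all add: pos_node_Suc)
  then show ?case by (intro exI[of _ 0]) (auto simp: true_stage_def node_0 pos_def)
next
  case (Suc i)
  then show ?case using next_true_stage by blast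
qed

text \<open>The padding \<open>j\<close> gives infinitely many positions with the same label and
  requirement, each with its own true stage.\<close>

lemma true_stage_unbounded:
  "\<exists>t>N. \<exists>i. true_stage X i t \<and> label (node X t) = l \<and> req (node X t) = r"
proof -
  define f where "f j = (SOME t. true_stage X (pair j (pair l r)) t)" for j
  have f: "true_stage X (pair j (pair l r)) (f j)" for j
    unfolding f_def by (rule someI_ex[OF ex_true_stage])
  have "inj f"
  proof (rule injI)
    fix j k assume "f j = f k"
    then show "j = k" using f[of j] f[of k] by (simp add: true_stage_def)
  qed
  then have "infinite (range f)" by (auto dest: finite_imageD)
  then obtain j where j: "N < f j" unfolding infinite_nat_iff_unbounded by blast
  show ?thesis
    using j f[of j] by (intro exI[of _ "f j"]) (auto simp: true_stage_def label_def req_def)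
qed

lemma lim_set_void_unbounded:
  "\<exists>n\<in>lim_set X. N < stage n \<and> label n = l \<and> req n = 0"
  using true_stage_unbounded[of N X l 0] true_void_in_lim_set by (metis stage_node)

lemma infinite_lim_set: "infinite (lim_set X)"
proof
  assume "finite (lim_set X)"
  then have "finite (stage ` lim_set X)" by simp
  then obtain N where "\<forall>k \<in> stage ` lim_set X. k < N" by (meson finite_nat_set_iff_bounded)
  then show False using lim_set_void_unbounded[of X N 0] by fastforce
qed

text \<open>At each stage the least threat is answered, and no threat is answered twice.\<close>

lemma no_permanent_threat: "\<exists>s\<ge>s0. \<not> threat (node X s) w"
proof (rule ccontr)
  assume "\<not> ?thesis"
  then have threat: "threat (node X s) w" if "s0 \<le> s" for s using that by blast
  \<comment> \<open>From \<open>M\<close> on, \<open>w\<close> is eligible, so all responses are at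
    most \<open>w\<close>; they are also distinct, because a victim never returns.\<close>
  define M where "M = max s0 (Suc w)"
  have le: "response (node X s) \<le> w" if "M \<le> s" for s
    unfolding response_def using threat[of s] that by (intro Least_le) (simp add: M_def)
  have acting: "acting X s" if "M \<le> s" for s
    using le[OF that] that by (simp add: acts_def M_def)
  have "inj_on (\<lambda>s. response (node X s)) {M..}"
  proof (rule linorder_inj_onI)
    fix s s' assume s: "s < s'" "s \<in> {M..}" "s' \<in> {M..}"
    have "victim X s \<notin> kept X s'"
      using victim_lost[OF acting s(1)] s by auto
    then have "victim X s \<noteq> victim X s'" using acting_facts(1)[OF acting[of s']] s by auto
    then show "response (node X s) \<noteq> response (node X s')" by (auto simp: target_def)
  qed (simp add: nat_le_linear)
  moreover have "(\<lambda>s. response (node X s)) ` {M..} \<subseteq> {..w}" using le by auto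
  ultimately have "finite {M..}" by (meson finite_atMost inj_on_finite)
  then show False using infinite_Ici by blast
qed

section \<open>The order of labels\<close>

lemma rel_oracle_pair [simp]: "rel_oracle R (pair a b) \<longleftrightarrow> (a, b) \<in> R"
  by (simp add: rel_oracle_def pair_def)

lemma not_label_less_refl: "\<not> label_less X P P"
  by (simp add: label_less_iff)

context
  fixes R :: "(nat \<times> nat) set"
  assumes lin: "linear_order_on UNIV R"
begin

lemma R_trans: "(a, b) \<in> R \<Longrightarrow> (b, c) \<in> R \<Longrightarrow> (a, c) \<in> R"
  using lin unfolding order_on_defs by (auto dest: transD)

lemma R_antisym: "(a, b) \<in> R \<Longrightarrow> (b, a) \<in> R \<Longrightarrow> a = b"
  using lin unfolding order_on_defs by (auto dest: antisymD)

lemma R_refl: "(a, a) \<in> R"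
  using lin unfolding order_on_defs by (auto dest: refl_onD)

lemma R_total: "(a, b) \<in> R \<or> (b, a) \<in> R"
  using lin R_refl unfolding order_on_defs total_on_def by (cases "a = b") auto

abbreviation lless :: "nat \<Rightarrow> nat \<Rightarrow> bool" where "lless \<equiv> label_less (rel_oracle R)"

lemma lless_iff:
  "lless P Q \<longleftrightarrow> (\<exists>d\<in>set_decode Q - set_decode P. \<forall>e\<in>set_decode P - set_decode Q. (e, d) \<in> R)"
  by (simp add: label_less_iff)

text \<open>The larger of the two witnesses serves for \<open>P\<close> and
  \<open>T\<close>.\<close>

lemma lless_trans:
  assumes "lless P Q" "lless Q T"
  shows "lless P T"
proof -
  obtain d where d: "d \<in> set_decode Q - set_decode P" "\<forall>e\<in>set_decode P - set_decode Q. (e, d) \<in> R"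
    using assms(1) unfolding lless_iff by blast
  obtain d' where d': "d' \<in> set_decode T - set_decode Q" "\<forall>e\<in>set_decode Q - set_decode T. (e, d') \<in> R"
    using assms(2) unfolding lless_iff by blast
  have "d \<noteq> d'" using d d' by blast
  show ?thesis
  proof (cases "(d, d') \<in> R")
    case True
    then have "d' \<in> set_decode T - set_decode P" using d d' \<open>d \<noteq> d'\<close> R_antisym by blast
    moreover have "\<forall>e\<in>set_decode P - set_decode T. (e, d') \<in> R" using d d' True R_trans by blast
    ultimately show ?thesis unfolding lless_iff by blast
  next
    case False
    then have "(d', d) \<in> R" using R_total by blast
    then have "d \<in> set_decode T - set_decode P" using d d' \<open>d \<noteq> d'\<close> R_antisym by blast
    moreover have "\<forall>e\<in>set_decode P - set_decode T. (e, d) \<in> R" using d d' \<open>(d', d) \<in> R\<close> R_trans by blast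
    ultimately show ?thesis unfolding lless_iff by blast
  qed
qed

lemma lless_asym: "lless P Q \<Longrightarrow> \<not> lless Q P"
  using lless_trans[of P Q P] not_label_less_refl[of _ P] by blast

lemma finite_has_R_max:
  assumes "finite U" "U \<noteq> {}"
  shows "\<exists>d\<in>U. \<forall>e\<in>U. (e, d) \<in> R"
  using assms
proof (induction rule: finite_ne_induct)
  case (insert x U)
  then obtain d where "d \<in> U" "\<forall>e\<in>U. (e, d) \<in> R" by blast
  then show ?case using R_total[of x d] R_refl R_trans by blast
qed (simp add: R_refl)

text \<open>The largest element of the symmetric difference decides.\<close>

lemma lless_total:
  assumes "P \<noteq> Q"
  shows "lless P Q \<or> lless Q P"
proof -
  let ?U = "(set_decode P - set_decode Q) \<union> (set_decode Q - set_decode P)"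
  have "set_decode P \<noteq> set_decode Q" using assms by (metis set_decode_inverse)
  then have "?U \<noteq> {}" by blast
  then obtain d where "d \<in> ?U" "\<forall>e\<in>?U. (e, d) \<in> R" using finite_has_R_max[of ?U] by auto
  then show ?thesis unfolding lless_iff by blast
qed

text \<open>The label order is contained in the multiset order over the strict part of
  \<open>R\<close>: passing from \<open>Q\<close> to \<open>P\<close> replaces the elements of
  \<open>Q\<close> outside \<open>P\<close>, among them \<open>d\<close>, by elements strictly below
  \<open>d\<close>.\<close>

lemma wf_lless:
  assumes "wf (R - Id)"
  shows "wf {(P, Q). lless P Q}"
proof (rule wf_subset)
  let ?m = "\<lambda>P. mset_set (set_decode P)"
  show "wf (inv_image (mult (R - Id)) ?m)" using assms by (intro wf_inv_image wf_mult)
  show "{(P, Q). lless P Q} \<subseteq> inv_image (mult (R - Id)) ?m"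
  proof clarify
    fix P Q assume "lless P Q"
    then obtain d where d: "d \<in> set_decode Q - set_decode P" "\<forall>e\<in>set_decode P - set_decode Q. (e, d) \<in> R"
      unfolding lless_iff by blast
    have split: "?m A = mset_set (set_decode A \<inter> set_decode B) + mset_set (set_decode A - set_decode B)" for A B
      by (subst mset_set_Union[symmetric]) (auto intro: arg_cong[where f = mset_set])
    have "(mset_set (set_decode P \<inter> set_decode Q) + mset_set (set_decode P - set_decode Q),
        mset_set (set_decode P \<inter> set_decode Q) + mset_set (set_decode Q - set_decode P)) \<in> mult (R - Id)"
      using d by (intro one_step_implies_mult) (auto simp: mset_set_empty_iff)
    then show "(P, Q) \<in> inv_image (mult (R - Id)) ?m"
      using split[of P Q] split[of Q P] by (simp add: Int_commute)
  qed
qed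

section \<open>Well-founded orders\<close>

text \<open>Otherwise the members of \<open>S\<close> beyond \<open>N\<close>, listed by stage,
  would carry an infinite descending sequence of labels.\<close>

lemma nondescending_pair:
  assumes wf: "wf (R - Id)" and S: "infinite S" "S \<subseteq> lim_set (rel_oracle R)"
  shows "\<exists>m\<in>S. \<exists>n\<in>S. N < stage m \<and> stage m < stage n \<and> (label m = label n \<or> lless (label m) (label n))"
proof (rule ccontr)
  assume neg: "\<not> ?thesis"
  define T where "T = {s \<in> stage ` S. N < s}"
  have "infinite (stage ` S)"
    using S inj_on_stage[OF S(2)] by (simp add: finite_image_iff)
  moreover have "stage ` S \<subseteq> T \<union> {..N}" unfolding T_def by auto
  ultimately have T: "infinite T" by (meson finite_UnI finite_atMost finite_subset)
  define g where "g i = node (rel_oracle R) (enumerate T i)" for i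
  have g: "g i \<in> S \<and> N < stage (g i)" for i
  proof -
    have "enumerate T i \<in> T" using T by (rule enumerate_in_set)
    then obtain k where "k \<in> S" "stage k = enumerate T i" "N < stage k" unfolding T_def by auto
    moreover from this have "k = node (rel_oracle R) (stage k)" using S(2) lim_set_iff by blast
    ultimately show ?thesis unfolding g_def by simp
  qed
  have "stage (g i) < stage (g (Suc i))" for i
    using enumerate_step[OF T] by (simp add: g_def)
  then have "lless (label (g (Suc i))) (label (g i))" for i
    using neg g lless_total by metis
  then show False
    using wf_lless[OF wf] unfolding wf_iff_no_infinite_down_chain
    by (auto dest!: spec[of _ "\<lambda>i. label (g i)"])
qed

end

text \<open>\<open>m\<close> and \<open>n\<close> form a non-descending pair beyond
  \<open>b\<close>. The later element \<open>a\<close> supplies the rest: its oracle bits verify the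
  comparison and its record of kept numbers gives the answer \<open>v\<close>. Hence this is
  decidable from \<open>S\<close> alone.\<close>

definition verdict :: "(nat \<Rightarrow> bool) \<Rightarrow> nat \<Rightarrow> nat \<Rightarrow> nat \<Rightarrow> nat \<Rightarrow> nat \<Rightarrow> bool" where
  "verdict S b v m n a \<longleftrightarrow> S m \<and> S n \<and> S a \<and> stage b < stage m \<and> stage m < stage n \<and> stage n < stage a \<and>
     (label m = label n \<or> label_less (known a) (label m) (label n)) \<and>
     (v = 1 \<and> b \<in> set_decode (alive a) \<or> v = 0 \<and> b \<notin> set_decode (alive a))"

text \<open>The program outputs the answer of the first verdict found. By
  \<open>verdict_sound\<close>, all verdicts from a subset of the limit set agree.\<close>

lemma ev_verdict:
  "\<exists>p. \<forall>S b. (\<exists>v m n a. verdict S b v m n a) \<longrightarrow> (\<exists>v m n a. verdict S b v m n a \<and> ev S p [b] v)"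
proof -
  let ?P = "\<lambda>S b y. verdict S b (pfst y) (pfst (psnd y)) (pfst (psnd (psnd y))) (psnd (psnd (psnd y)))"
  have "decidable (\<lambda>S z. ?P S (pfst z) (psnd z))"
    unfolding verdict_def by (intro computable_intros computable_node_intros decidable_label_less)
  then obtain p where p: "\<And>S b y. ev S p [b] y \<longleftrightarrow> ?P S b y \<and> (\<forall>z<y. \<not> ?P S b z)"
    using ev_Mn_decidable[of ?P] by blast
  have "computable (\<lambda>S. pfst)" by (intro computable_intros)
  then obtain q where q: "\<And>S y. ev S q [y] (pfst y)" unfolding computable_def by blast
  have "\<exists>v m n a. verdict S b v m n a \<and> ev S (Comp q [p]) [b] v" if ver: "verdict S b v m n a" for S b v m n a
  proof -
    have "?P S b (pair v (pair m (pair n a)))" using ver by simp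
    then obtain y where y: "?P S b y" "\<forall>z<y. \<not> ?P S b z"
      using exists_least_iff[of "?P S b"] by blast
    have "ev S (Comp q [p]) [b] (pfst y)"
      by (rule ev_comp[where ys = "[y]"]) (use y p q in auto)
    then show ?thesis using y(1) by blast
  qed
  then show ?thesis by blast
qed

context
  fixes R :: "(nat \<times> nat) set"
  assumes lin: "linear_order_on UNIV R"
begin

text \<open>If \<open>b\<close> is kept when \<open>a\<close> enters, then
  \<open>kept_secure\<close> makes it permanent. If not, it is lost or never entered, since
  \<open>a\<close> is later than \<open>b\<close>.\<close>

lemma verdict_sound:
  assumes ver: "verdict (\<lambda>k. k \<in> S) b v m n a" and S: "S \<subseteq> lim_set (rel_oracle R)"
  shows "v = (if b \<in> lim_set (rel_oracle R) then 1 else 0)"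
proof -
  from ver have mem: "m \<in> lim_set (rel_oracle R)" "n \<in> lim_set (rel_oracle R)" "a \<in> lim_set (rel_oracle R)"
    and st: "stage b < stage m" "stage m < stage n" "stage n < stage a"
    and le: "label m = label n \<or> label_less (known a) (label m) (label n)"
    and v: "v = 1 \<and> b \<in> set_decode (alive a) \<or> v = 0 \<and> b \<notin> set_decode (alive a)"
    using S unfolding verdict_def by auto
  obtain s where a: "a = node (rel_oracle R) s" "stage a = s" using mem(3) lim_set_iff stage_node by metis
  then have alive: "set_decode (alive a) = kept (rel_oracle R) s" by (simp add: kept_def)
  have "label m = label n \<or> lless R (label m) (label n)"
    using le label_less_known a by blast
  then have "\<not> lless R (label n) (label m)"
    using lless_asym[OF lin] not_label_less_refl by metis
  then have "b \<in> lim_set (rel_oracle R)" if "b \<in> kept (rel_oracle R) s"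
    using kept_secure[OF that mem(1,2)] st a by simp
  moreover have "b \<in> kept (rel_oracle R) s" if "b \<in> lim_set (rel_oracle R)"
    using that st a by (auto simp: lim_set_iff)
  ultimately show ?thesis using v alive by auto
qed

lemma verdict_exists:
  assumes "wf (R - Id)" "infinite S" "S \<subseteq> lim_set (rel_oracle R)"
  shows "\<exists>v m n a. verdict (\<lambda>k. k \<in> S) b v m n a"
proof -
  obtain m n where mn: "m \<in> S" "n \<in> S" "stage b < stage m" "stage m < stage n"
    "label m = label n \<or> lless R (label m) (label n)"
    using nondescending_pair[OF lin assms] by blast
  have "\<forall>\<^sub>F s in sequentially. label m = label n \<or> label_less (known (node (rel_oracle R) s)) (label m) (label n)"
    using mn(5) label_less_eventually_known by (cases "label m = label n") auto
  then obtain s0 where s0: "\<And>s. s0 \<le> s \<Longrightarrow>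
      label m = label n \<or> label_less (known (node (rel_oracle R) s)) (label m) (label n)"
    by (auto simp: eventually_sequentially)
  have "infinite (stage ` S)"
    using assms inj_on_stage[OF assms(3)] by (simp add: finite_image_iff)
  \<comment> \<open>\<open>a\<close> is late enough for its oracle bits to confirm the comparison of
    \<open>m\<close> and \<open>n\<close>.\<close>
  then obtain a where a: "a \<in> S" "max s0 (stage n) < stage a"
    unfolding infinite_nat_iff_unbounded by blast
  moreover have "a = node (rel_oracle R) (stage a)" using a assms(3) lim_set_iff by blast
  ultimately have "label m = label n \<or> label_less (known a) (label m) (label n)"
    using s0[of "stage a"] by simp
  with mn a have "verdict (\<lambda>k. k \<in> S) b (of_bool (b \<in> set_decode (alive a))) m n a"
    by (simp add: verdict_def)
  then show ?thesis by blast
qed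

end

theorem uniformly_introreducible_lim_set:
  assumes "well_order_on UNIV R"
  shows "uniformly_introreducible (lim_set (rel_oracle R))"
proof -
  from assms have lin: "linear_order_on UNIV R" and wf: "wf (R - Id)"
    unfolding well_order_on_def by auto
  obtain p where p: "\<And>S b. \<exists>v m n a. verdict S b v m n a \<Longrightarrow> \<exists>v m n a. verdict S b v m n a \<and> ev S p [b] v"
    using ev_verdict by blast
  have "computes p S (lim_set (rel_oracle R))" if S: "infinite S" "S \<subseteq> lim_set (rel_oracle R)" for S
    unfolding computes_def
  proof
    fix b
    obtain v m n a where ver: "verdict (\<lambda>k. k \<in> S) b v m n a" "ev (\<lambda>k. k \<in> S) p [b] v"
      using p[OF verdict_exists[OF lin wf S]] by blast
    then show "ev (\<lambda>k. k \<in> S) p [b] (if b \<in> lim_set (rel_oracle R) then 1 else 0)"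
      using verdict_sound[OF lin ver(1) S(2)] by simp
  qed
  then show ?thesis unfolding uniformly_introreducible_def using infinite_lim_set by blast
qed

section \<open>Ill-founded orders\<close>

text \<open>A condition \<open>(F, w, u)\<close> promises that the elements added to \<open>F\<close> have labels between \<open>w\<close> and \<open>u\<close>,
  where \<open>w\<close> and \<open>u\<close> belong to a dense chain of labels.\<close>

locale dense_labels =
  fixes R :: "(nat \<times> nat) set" and Q :: "nat set"
  assumes lin: "linear_order_on UNIV R"
    and dense: "\<lbrakk>w \<in> Q; u \<in> Q; lless R w u\<rbrakk> \<Longrightarrow> \<exists>z\<in>Q. lless R w z \<and> lless R z u"
    and nontrivial: "\<exists>w\<in>Q. \<exists>u\<in>Q. lless R w u"
begin

abbreviation X :: "nat \<Rightarrow> bool" where "X \<equiv> rel_oracle R"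

text \<open>The labels of \<open>F\<close> are at least \<open>u\<close>, so a later element with a
  label below \<open>u\<close> continues the descent; \<open>w\<close> keeps room for infinitely
  many more.\<close>

definition cond :: "nat set \<Rightarrow> nat \<Rightarrow> nat \<Rightarrow> bool" where
  "cond F w u \<longleftrightarrow> finite F \<and> F \<subseteq> lim_set X \<and> (\<forall>f\<in>F. req f = 0) \<and> descending X F \<and>
     w \<in> Q \<and> u \<in> Q \<and> lless R w u \<and> (\<forall>f\<in>F. u = label f \<or> lless R u (label f))"

definition admissible :: "nat set \<Rightarrow> nat set \<Rightarrow> nat \<Rightarrow> bool" where
  "admissible S F w \<longleftrightarrow> S \<subseteq> lim_set X \<and> (\<forall>x\<in>S. req x = 0) \<and> descending X S \<and> F \<subseteq> S \<and>
     (\<forall>x\<in>S - F. lless R w (label x) \<and> (\<forall>f\<in>F. stage f < stage x))"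

text \<open>Strict inclusion makes the union of a sequence of extensions infinite.\<close>

definition extension :: "nat set \<Rightarrow> nat \<Rightarrow> nat set \<Rightarrow> nat \<Rightarrow> bool" where
  "extension F w F' w' \<longleftrightarrow> F \<subset> F' \<and> (w = w' \<or> lless R w w') \<and>
     (\<forall>x\<in>F' - F. lless R w (label x) \<and> (\<forall>f\<in>F. stage f < stage x))"

text \<open>Density yields \<open>z\<close> between the bounds; void elements with label
  \<open>z\<close> occur arbitrarily late, and \<open>z\<close> becomes the new upper bound.\<close>

lemma add_element:
  assumes "cond F w u"
  shows "\<exists>x z. cond (insert x F) w z \<and> N < stage x \<and> (\<forall>f\<in>F. stage f < stage x) \<and> lless R w (label x)"
proof -
  obtain z where z: "z \<in> Q" "lless R w z" "lless R z u" using assms dense unfolding cond_def by blast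
  have "finite (stage ` F)" using assms by (simp add: cond_def)
  then obtain M where M: "\<forall>k\<in>stage ` F. k < M" by (meson finite_nat_set_iff_bounded)
  obtain x where x: "x \<in> lim_set X" "max N M < stage x" "label x = z" "req x = 0"
    using lim_set_void_unbounded by blast
  have st: "\<forall>f\<in>F. stage f < stage x" using M x by fastforce
  have above: "lless R z (label f)" if "f \<in> F" for f
    using that assms z lless_trans[OF lin, of z u "label f"] unfolding cond_def by metis
  then have "descending X (insert x F)"
    using assms st x unfolding cond_def descending_def by auto
  then have "cond (insert x F) w z" using assms z x above unfolding cond_def by auto
  then show ?thesis using x st z by auto
qed

text \<open>The action has removed \<open>b\<close>, although the program answers 1 on
  \<open>F\<close> together with the rescued numbers. The new condition contains these and an
  element \<open>x\<close> entering after the action, which freezes the oracle below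
  \<open>s\<close>. So the answer is wrong on every admissible set.\<close>

lemma diagonalise_acting:
  assumes c: "cond F w u" and q: "q \<in> Q" "lless R w q" "lless R q u"
    and b: "req b = Suc (pair e (pair (set_encode F) q))" "\<forall>f\<in>F. stage f < stage b"
    and act: "acting X s" "victim X s = b" and saved: "rescued X s \<subseteq> lim_set X"
  shows "\<exists>F' w' u'. cond F' w' u' \<and> extension F w F' w' \<and>
    (\<forall>S p. code p = e \<longrightarrow> admissible S F' w' \<longrightarrow> \<not> computes p S (lim_set X))"
proof -
  let ?D = "rescued X s"
  have parts: "set_decode (req_stem b) = F" "req_bound b = q" "req_prog b = e"
    using b c unfolding req_stem_def req_bound_def req_prog_def cond_def by simp_all
  have D: "req d = 0" "stage b < stage d" "lless R q (label d)" if "d \<in> ?D" for d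
    using acting_facts(3)[OF act(1) that] act(2) parts by auto
  \<comment> \<open>The rescued labels lie above \<open>q\<close>, so lowering the upper bound to
    \<open>q\<close> makes room for them.\<close>
  have cD: "cond (F \<union> ?D) w q"
    using c q saved D acting_facts(4)[OF act(1)] act(2) parts lless_trans[OF lin, of q u]
    unfolding cond_def by auto
  obtain x z where x: "cond (insert x (F \<union> ?D)) w z" "s < stage x" "\<forall>f\<in>F \<union> ?D. stage f < stage x"
    "lless R w (label x)"
    using add_element[OF cD] by blast
  have "lless R w (label y) \<and> (\<forall>f\<in>F. stage f < stage y)" if "y \<in> ?D" for y
    using lless_trans[OF lin q(2) D(3)[OF that]] b(2) D(2)[OF that] by (meson less_trans)
  moreover have "x \<notin> F" using x(3) by blast
  ultimately have "extension F w (insert x (F \<union> ?D)) w"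
    using x(3,4) unfolding extension_def by blast
  moreover have "\<not> computes p S (lim_set X)"
    if p: "code p = e" and S: "admissible S (insert x (F \<union> ?D)) w" for S p
  proof
    assume "computes p S (lim_set X)"
    moreover have "b \<notin> lim_set X"
    proof -
      have "b \<notin> kept X (Suc (max s b))" using victim_lost[OF act(1)] act(2) by simp
      then show ?thesis unfolding lim_set_def by (blast intro: le_imp_less_Suc max.cobounded2)
    qed
    ultimately have "ev (\<lambda>k. k \<in> S) p [b] 0" unfolding computes_def by metis
    moreover obtain C where C: "certifies (restr (\<lambda>k. k \<in> F \<union> ?D) s) C (claim 0 (code p) (list_encode [b]) 1)"
      using acting_facts(5)[OF act(1)] act(2) parts p by (auto simp: lcons_def pair_def)
    \<comment> \<open>All other members of \<open>S\<close> have stages at least that of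
      \<open>x\<close>, so as numbers they exceed \<open>s\<close>.\<close>
    have "k \<in> S \<longleftrightarrow> k \<in> F \<union> ?D" if "k < s" for k
    proof
      assume "k \<in> S"
      have "stage k < stage x" using that x(2) stage_le[of k] by linarith
      then have "k \<noteq> x" "\<not> stage x < stage k" by auto
      then show "k \<in> F \<union> ?D" using S \<open>k \<in> S\<close> unfolding admissible_def by blast
    next
      assume "k \<in> F \<union> ?D"
      then show "k \<in> S" using S unfolding admissible_def by blast
    qed
    then have "ev (\<lambda>k. k \<in> S) p [b] 1"
      by (intro certifies_sound[OF C]) (auto simp: restr_def)
    ultimately show False using ev_deterministic by fastforce
  qed
  ultimately show ?thesis using x(1) by blast
qed

text \<open>Here \<open>b\<close> stays in the set, and the lower bound is raised to
  \<open>q\<close>. If an admissible \<open>S\<close> gave the answer 1 at \<open>b\<close>, the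
  finite part of \<open>S\<close> used would be a threat at all late stages.\<close>

lemma diagonalise_waiting:
  assumes c: "cond F w u" and q: "q \<in> Q" "lless R w q" "lless R q u"
    and b: "req b = Suc (pair e (pair (set_encode F) q))" "\<forall>f\<in>F. stage f < stage b" "b \<in> lim_set X"
  shows "\<exists>F' w' u'. cond F' w' u' \<and> extension F w F' w' \<and>
    (\<forall>S p. code p = e \<longrightarrow> admissible S F' w' \<longrightarrow> \<not> computes p S (lim_set X))"
proof -
  have parts: "set_decode (req_stem b) = F" "req_bound b = q" "req_prog b = e"
    using b c unfolding req_stem_def req_bound_def req_prog_def cond_def by simp_all
  have cq: "cond F q u" using c q unfolding cond_def by auto
  \<comment> \<open>Since \<open>x\<close> enters after \<open>b\<close>, so does everything added
    to \<open>F\<close>, as a threat demands.\<close>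
  obtain x z where x: "cond (insert x F) q z" "stage b < stage x" "\<forall>f\<in>F. stage f < stage x"
    "lless R q (label x)"
    using add_element[OF cq] by blast
  have "x \<notin> F" using x(3) by blast
  have "extension F w (insert x F) q"
    unfolding extension_def using x q lless_trans[OF lin q(2)] \<open>x \<notin> F\<close> by auto
  moreover have "\<not> computes p S (lim_set X)"
    if p: "code p = e" and S: "admissible S (insert x F) q" for S p
  proof
    assume "computes p S (lim_set X)"
    then have "ev (\<lambda>k. k \<in> S) p [b] 1" using b(3) unfolding computes_def by metis
    then obtain s0 C where C: "certifies (restr (\<lambda>k. k \<in> S) s0) C (claim 0 (code p) (list_encode [b]) 1)"
      using certifies_complete by blast
    \<comment> \<open>A number is at least its stage, so \<open>F \<union> D\<close> agrees with
      \<open>S\<close> on all queries below \<open>s0\<close>.\<close>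
    define D where "D = {d \<in> S - F. stage d < s0}"
    have SA: "S \<subseteq> lim_set X" using S by (simp add: admissible_def)
    have "finite (stage ` D)"
      by (rule finite_subset[of _ "{..<s0}"]) (auto simp: D_def)
    moreover have "inj_on stage D" by (rule inj_on_stage[of _ X]) (use SA in \<open>auto simp: D_def\<close>)
    ultimately have finD: "finite D" by (rule finite_imageD)
    have D: "req d = 0" "stage b < stage d" "lless R q (label d)" "d \<in> lim_set X" if "d \<in> D" for d
    proof -
      have "d \<in> S" "d = x \<or> d \<in> S - insert x F" using that by (auto simp: D_def)
      then show "req d = 0" "stage b < stage d" "lless R q (label d)" "d \<in> lim_set X"
        using S x(2,4) unfolding admissible_def by (auto dest: less_trans)
    qed
    have G: "F \<union> D \<subseteq> S" "finite (F \<union> D)" "descending X (F \<union> D)"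
      using S finD c unfolding admissible_def D_def cond_def descending_def by auto
    have restr: "restr (\<lambda>k. k \<in> F \<union> D) s k v" if "restr (\<lambda>k. k \<in> S) s0 k v" "s0 \<le> s" for s k v
      using that stage_le[of k] G(1) unfolding restr_def D_def by auto
    have "\<forall>\<^sub>F s in sequentially. \<forall>d\<in>D. d \<in> kept X s \<and> label_less (known (node X s)) q (label d)"
    proof (intro eventually_ball_finite finD ballI eventually_conj)
      fix d assume d: "d \<in> D"
      show "\<forall>\<^sub>F s in sequentially. d \<in> kept X s"
        by (rule eventually_mono[OF eventually_gt_at_top[of "stage d"]])
          (use D(4)[OF d] in \<open>simp add: lim_set_iff\<close>)
      show "\<forall>\<^sub>F s in sequentially. label_less (known (node X s)) q (label d)"
        using label_less_eventually_known D(3)[OF d] .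
    qed
    moreover have "\<forall>\<^sub>F s in sequentially. descending (known (node X s)) (F \<union> D)"
      unfolding descending_def
    proof (intro eventually_ball_finite G(2) ballI)
      fix y y' assume "y \<in> F \<union> D" "y' \<in> F \<union> D"
      then show "\<forall>\<^sub>F s in sequentially. stage y < stage y' \<longrightarrow> label_less (known (node X s)) (label y') (label y)"
        using G(3) label_less_eventually_known unfolding descending_def by (cases "stage y < stage y'") auto
    qed
    moreover have "\<forall>\<^sub>F s in sequentially. b \<in> kept X s"
      by (rule eventually_mono[OF eventually_gt_at_top[of "stage b"]])
        (use b(3) in \<open>simp add: lim_set_iff\<close>)
    moreover have "\<forall>\<^sub>F s in sequentially. certifies (restr (\<lambda>k. k \<in> F \<union> D) s) C (claim 0 e (lcons b 0) 1)"
      using eventually_ge_at_top[of s0]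
    proof eventually_elim
      case (elim s)
      have "certifies (restr (\<lambda>k. k \<in> F \<union> D) s) C (claim 0 (code p) (list_encode [b]) 1)"
        using C by (rule certifies_mono) (rule restr[OF _ elim])
      then show ?case using p by (simp add: lcons_def pair_def)
    qed
    ultimately have "\<forall>\<^sub>F s in sequentially. threat (node X s) (pair b (pair (set_encode D) C))"
      by eventually_elim
        (use b D(1,2) finD parts in \<open>simp add: threat_def threat_by_iff kept_def\<close>)
    then show False using no_permanent_threat unfolding eventually_sequentially by blast
  qed
  ultimately show ?thesis using x(1) by blast
qed

text \<open>At a true stage whose requirement codes \<open>e\<close>, \<open>F\<close> and
  \<open>q\<close>, the entering number either falls victim later or stays for ever.\<close>

lemma diagonalise:
  assumes "cond F w u"
  shows "\<exists>F' w' u'. cond F' w' u' \<and> extension F w F' w' \<and>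
    (\<forall>S p. code p = e \<longrightarrow> admissible S F' w' \<longrightarrow> \<not> computes p S (lim_set X))"
proof -
  obtain q where q: "q \<in> Q" "lless R w q" "lless R q u" using assms dense unfolding cond_def by blast
  have "finite (stage ` F)" using assms by (simp add: cond_def)
  then obtain N where N: "\<forall>k\<in>stage ` F. k < N" by (meson finite_nat_set_iff_bounded)
  obtain t i where t: "N < t" "true_stage X i t" "req (node X t) = Suc (pair e (pair (set_encode F) q))"
    using true_stage_unbounded by blast
  have st: "\<forall>f\<in>F. stage f < stage (node X t)" using N t(1) by fastforce
  show ?thesis
  proof (cases "\<exists>s>t. acting X s \<and> victim X s = node X t")
    case True
    then obtain s where s: "t < s" "acting X s" "victim X s = node X t" by blast
    show ?thesis
      by (rule diagonalise_acting[OF assms q t(3) st s(2,3) true_acting_rescued[OF t(2) s]])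
  next
    case False
    then have "node X t \<in> lim_set X" using true_not_acting_in_lim_set[OF t(2)] by blast
    then show ?thesis by (rule diagonalise_waiting[OF assms q t(3) st])
  qed
qed

text \<open>Round \<open>e\<close> defeats the programs with code \<open>e\<close>. The union of the
  stems is admissible for every condition of the sequence, so it inherits all these
  failures.\<close>

theorem not_introreducible: "\<not> introreducible (lim_set X)"
proof
  assume intro: "introreducible (lim_set X)"
  define P where "P e c \<longleftrightarrow> (case c of (F, w, u) \<Rightarrow> cond F w u)" for e :: nat and c
  define E where "E e c c' \<longleftrightarrow> (case c of (F, w, u) \<Rightarrow> case c' of (F', w', u') \<Rightarrow> extension F w F' w' \<and>
    (\<forall>S p. code p = e \<longrightarrow> admissible S F' w' \<longrightarrow> \<not> computes p S (lim_set X)))"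
    for e and c c' :: "nat set \<times> nat \<times> nat"
  have "\<exists>f. \<forall>e. P e (f e) \<and> E e (f e) (f (Suc e))"
  proof (rule dependent_nat_choice)
    obtain w u where "w \<in> Q" "u \<in> Q" "lless R w u" using nontrivial by blast
    then have "cond {} w u" by (simp add: cond_def descending_def)
    then show "\<exists>c. P 0 c" unfolding P_def by auto
  next
    fix c e assume "P e c"
    then show "\<exists>c'. P (Suc e) c' \<and> E e c c'"
      using diagonalise[of "fst c" "fst (snd c)" "snd (snd c)" e] unfolding P_def E_def by fastforce
  qed
  then obtain f where f: "\<And>e. P e (f e)" "\<And>e. E e (f e) (f (Suc e))" by blast
  define F w where "F e = fst (f e)" and "w e = fst (snd (f e))" for e
  have cond: "\<exists>u. cond (F e) (w e) u" for e
    using f(1)[of e] unfolding P_def F_def w_def by (auto split: prod.splits)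
  have ext: "extension (F e) (w e) (F (Suc e)) (w (Suc e))" for e
    using f(2)[of e] unfolding E_def F_def w_def by (auto split: prod.splits)
  have diag: "\<not> computes p S (lim_set X)" if "code p = e" "admissible S (F (Suc e)) (w (Suc e))" for e p S
    using f(2)[of e] that unfolding E_def F_def w_def by (auto split: prod.splits)
  have mono: "F i \<subseteq> F j" if "i \<le> j" for i j
    by (rule lift_Suc_mono_le[OF _ that]) (use ext in \<open>auto simp: extension_def\<close>)
  have w_mono: "w i = w j \<or> lless R (w i) (w j)" if "i \<le> j" for i j
    using that
  proof (induction j rule: dec_induct)
    case (step j)
    then show ?case using ext[of j] lless_trans[OF lin, of "w i" "w j" "w (Suc j)"] unfolding extension_def by auto
  qed simp
  define S where "S = (\<Union>e. F e)"
  have "card (F e) \<ge> e" for e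
  proof (induction e)
    case (Suc e)
    have "card (F e) < card (F (Suc e))"
      using ext[of e] cond[of "Suc e"] by (intro psubset_card_mono) (auto simp: extension_def cond_def)
    then show ?case using Suc by simp
  qed simp
  moreover have "card (F e) \<le> card S" if "finite S" for e
    using that by (intro card_mono) (auto simp: S_def)
  ultimately have inf: "infinite S" by (metis Suc_n_not_le_n le_trans)
  \<comment> \<open>What is added after round \<open>i\<close> respects the bound of that round,
    because the lower bounds never fall.\<close>
  have later: "x \<in> F j \<Longrightarrow> x \<notin> F i \<Longrightarrow> lless R (w i) (label x) \<and> (\<forall>f\<in>F i. stage f < stage x)" for i j x
  proof (induction j)
    case 0
    then show ?case using mono[of 0 i] by auto
  next
    case (Suc j)
    show ?case
    proof (cases "x \<in> F j")
      case False
      have "i \<le> j" using Suc.prems mono[of "Suc j" i] by (meson not_less_eq_eq subsetD)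
      then show ?thesis
        using False Suc.prems ext[of j] mono[of i j] w_mono[of i j] lless_trans[OF lin, of "w i" "w j" "label x"]
        unfolding extension_def by auto
    qed (use Suc in blast)
  qed
  have S: "S \<subseteq> lim_set X" "\<forall>x\<in>S. req x = 0"
    using cond unfolding S_def cond_def by blast+
  have "descending X S"
    unfolding descending_def
  proof (intro ballI impI)
    fix x y assume "x \<in> S" "y \<in> S" "stage x < stage y"
    then obtain i j where "x \<in> F i" "y \<in> F j" unfolding S_def by blast
    then have "x \<in> F (max i j)" "y \<in> F (max i j)" using mono[of i "max i j"] mono[of j "max i j"] by auto
    then show "lless R (label y) (label x)"
      using cond[of "max i j"] \<open>stage x < stage y\<close> unfolding cond_def descending_def by blast
  qed
  then have "admissible S (F e) (w e)" for e
    using S later unfolding admissible_def S_def by blast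
  moreover obtain p where "computes p S (lim_set X)"
    using intro inf S(1) unfolding introreducible_def by blast
  ultimately show False using diag by blast
qed

end

text \<open>Between \<open>w\<close> and \<open>u\<close> lies \<open>w\<close> with one added
  element \<open>l n\<close> below everything in both: this exceeds \<open>w\<close>, and the
  element \<open>d\<close> that puts \<open>w\<close> below \<open>u\<close> still does so for the
  new set.\<close>

lemma dense_labels_of_descending:
  assumes lin: "linear_order_on UNIV R" and l: "\<And>i. (l (Suc i), l i) \<in> R - Id"
  shows "dense_labels R {P. set_decode P \<subseteq> range l}"
proof
  have l_less: "(l j, l i) \<in> R \<and> l j \<noteq> l i" if "i < j" for i j
    using that
  proof (induction j)
    case (Suc j)
    then show ?case
      using l[of j] R_trans[OF lin, of "l (Suc j)" "l j" "l i"] R_antisym[OF lin, of "l i" "l j"]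
      by (cases "i = j") auto
  qed simp
  show "\<exists>w\<in>{P. set_decode P \<subseteq> range l}. \<exists>u\<in>{P. set_decode P \<subseteq> range l}. lless R w u"
  proof (rule bexI[of _ 0], rule bexI[of _ "set_encode {l 0}"])
    have "set_decode (set_encode {l 0}) = {l 0}" by (rule set_encode_inverse) simp
    then show "lless R 0 (set_encode {l 0})" "set_encode {l 0} \<in> {P. set_decode P \<subseteq> range l}"
      unfolding lless_iff[OF lin] by simp_all
  qed simp
  fix w u assume wu: "w \<in> {P. set_decode P \<subseteq> range l}" "u \<in> {P. set_decode P \<subseteq> range l}" "lless R w u"
  obtain d where d: "d \<in> set_decode u - set_decode w" "\<forall>e\<in>set_decode w - set_decode u. (e, d) \<in> R"
    using wu(3) unfolding lless_iff[OF lin] by blast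
  have "\<exists>I. finite I \<and> set_decode w \<union> set_decode u = l ` I"
    using wu by (intro finite_subset_image[of "set_decode w \<union> set_decode u" l UNIV, simplified]) auto
  then obtain I where I: "finite I" "set_decode w \<union> set_decode u = l ` I" by blast
  then obtain n where n: "\<forall>i\<in>I. i < n" by (meson finite_nat_set_iff_bounded)
  have below: "(l n, e) \<in> R \<and> l n \<noteq> e" if "e \<in> set_decode w \<union> set_decode u" for e
    using that l_less n unfolding I by blast
  let ?z = "set_encode (insert (l n) (set_decode w))"
  have z: "set_decode ?z = insert (l n) (set_decode w)" by (rule set_encode_inverse) simp
  have "lless R w ?z" unfolding lless_iff[OF lin] z using below by blast
  moreover have "lless R ?z u" unfolding lless_iff[OF lin] z using below d by blast
  moreover have "?z \<in> {P. set_decode P \<subseteq> range l}" using wu z by auto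
  ultimately show "\<exists>z\<in>{P. set_decode P \<subseteq> range l}. lless R w z \<and> lless R z u" by blast
qed (rule lin)

theorem theorem1p6:
  shows "\<exists>p :: prog. \<forall>R :: (nat \<times> nat) set. linear_order_on UNIV R \<longrightarrow>
     (let A = - dom_rel (rel_oracle R) p in
        (well_order_on UNIV R \<longrightarrow> uniformly_introreducible A) \<and>
        (\<not> well_order_on UNIV R \<longrightarrow> \<not> introreducible A))"
proof -
  \<comment> \<open>The program is chosen before the oracle, which gives the uniformity in
    \<open>R\<close>.\<close>
  obtain p where p: "\<And>X. - dom_rel X p = lim_set X" using complement_lim_set_ce by blast
  have "\<not> introreducible (lim_set (rel_oracle R))"
    if lin: "linear_order_on UNIV R" and "\<not> well_order_on UNIV R" for R :: "(nat \<times> nat) set"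
  proof -
    have "\<not> wf (R - Id)" using that by (simp add: well_order_on_def)
    then obtain l where "\<And>i. (l (Suc i), l i) \<in> R - Id"
      unfolding wf_iff_no_infinite_down_chain by blast
    then interpret dense_labels R "{P. set_decode P \<subseteq> range l}"
      by (rule dense_labels_of_descending[OF lin])
    show ?thesis by (rule not_introreducible)
  qed
  then show ?thesis
    using uniformly_introreducible_lim_set by (intro exI[of _ p]) (simp add: p)
qed

end
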